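(* For every $\mathcal X\in\mathbb D$ and every Brownian motion sample path $\omega$ there exists a unique two-sided reflection mapping $(Y^{\uparrow*},Y^{\downarrow*})$, i.e. a unique pair $(Y^{\uparrow*},Y^{\downarrow*})\in\mathbb Y\times\mathbb Y$ with $$Y^{\uparrow*}=\psi^\uparrow(\mathcal X,Y^{\downarrow*},\omega)\quad\text{and}\quad Y^{\downarrow*}=\psi^\downarrow(\mathcal X,Y^{\uparrow*},\omega).$$
   Context: Model. Parameters: lead time $\ell>0$, discount rate $\gamma>0$, drift $\mu\in\mathbb R$, standard deviation $\sigma>0$, unit costs $k^\uparrow,k^\downarrow>0$, and $M>0$. $\Omega$ is the set of continuous functions $\omega:[0,\infty)\to\mathbb R$, $W_t(\omega)=\omega(t)$, $\mathscr F=\sigma(W_t,t\ge0)$, $\mathscr F_t=\sigma(W_s,0\le s\le t)$, and $\mathbb P$ is the probability on $(\Omega,\mathscr F)$ under which $W$ is a Brownian motion started at $0$ with drift $\mu$ and variance $\sigma^2$; $\mathbb E$ is its expectation. The holding cost $h:\mathbb R\to[0,\infty)$ is convex and piecewise $C^2$, $h(0)=0$, $|h'|\le M$. $\mathbb D$ is the set of functions $\mathcal X:[0,\infty)\to\mathbb R$ that are right-continuous with left limits, non-decreasing, and constant on $[\ell,\infty)$; $\mathcal X+a$ is $u\mapsto\mathcal X(u)+a$; $\mathbf 0$ is the zero function; $\theta_s(\mathcal X)$ is $u\mapsto\mathcal X(s+u)$. A policy is a pair $\pi=(Y^\uparrow,Y^\downarrow)$ of $(\mathscr F_t)$-adapted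 non-negative non-decreasing right-continuous processes, with $Y^\uparrow(t)=Y^\downarrow(t)=0$ for $t<0$ (an adjustment at time $0$ counts as a jump at $0$ in integrals $\int_0^\infty\cdot\,dY$). $\Pi$ is the set of policies with $\mathbb E[\int_0^\infty e^{-\gamma t}(dY^\uparrow(t)+dY^\downarrow(t))]<\infty$. From initial state $\mathcal X$ under $\pi$, the state at time $t$ is $\mathcal X_t(u)=\mathcal X(t+u)+W_t+Y^\uparrow(t+(u\wedge\ell)-\ell)-Y^\downarrow(t)$, $u\ge0$. The cost is $C(\mathcal X,\pi)=\mathbb E[\int_0^\infty e^{-\gamma t}h(\mathcal X_t(0))dt+\int_0^\infty e^{-\gamma t}(k^\uparrow dY^\uparrow(t)+k^\downarrow dY^\downarrow(t))]$, and $C^*(\mathcal X)=\inf_{\pi\in\Pi}C(\mathcal X,\pi)$. Marginal costs. For $\xi^\uparrow,\xi^\downarrow\ge0$ let $\Phi_{\xi^\uparrow,\xi^\downarrow}(\mathcal X)(u)=\mathcal X(u)-\xi^\downarrow+\xi^\uparrow\mathbf 1_{\{u\ge\ell\}}$ and $C(\mathcal X,\xi^\uparrow,\xi^\downarrow)=k^\uparrow\xi^\uparrow+k^\downarrow\xi^\downarrow+C^*(\Phi_{\xi^\uparrow,\xi^\downarrow}(\mathcal X))$. The paper takes this function to be convex and differentiable in $\xi^\uparrow$ and in $\xi^\downarrow$ (right derivatives at $0$); $\frac{\partial C}{\partial\xi^\uparrow},\frac{\partial C}{\partial\xi^\downarrow}$ denote its partial derivatives. Let $$w^\uparrow_{\mathcal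 X}(s)=\max\{w\in\mathbb R:\tfrac{\partial C(\theta_s(\mathcal X)+w,0,0)}{\partial\xi^\uparrow}=0\},\qquad w^\downarrow_{\mathcal X}(s)=\min\{w\in\mathbb R:\tfrac{\partial C(\theta_s(\mathcal X)+w,0,0)}{\partial\xi^\downarrow}=0\}$$ (with $\max\emptyset=-\infty$, $\min\emptyset=+\infty$). Reflection. $\mathbb D^\uparrow=\{\mathcal X\in\mathbb D:w^\uparrow_{\mathcal X}(0)>0\}$ and $\mathbb D^\downarrow=\{\mathcal X\in\mathbb D:w^\downarrow_{\mathcal X}(0)<0\}$ are the sets of states in which an upward, respectively downward, adjustment is needed; $\bar{\mathbb D}^\uparrow,\bar{\mathbb D}^\downarrow$ are their complements in $\mathbb D$. Standing assumption: $\mathbb D^\uparrow\cap\mathbb D^\downarrow=\emptyset$, which the paper identifies with $w^\downarrow_{\mathbf 0}(\ell)>w^\uparrow_{\mathbf 0}(\ell)$. Let $\mathbb Y$ be the set of non-negative non-decreasing right-continuous functions on $[0,\infty)$, extended by $0$ to negative times. For $\{i,j\}=\{\uparrow,\downarrow\}$, $\mathcal X\in\mathbb D$, a continuous path $\omega$ with $\omega(0)=0$ and $Y^j\in\mathbb Y$, let $\Pi^i(\mathcal X,Y^j,\omega)$ be the set of $Y^i\in\mathbb Y$ such that for all $s\ge0$ the state $\mathcal X_s(u)=\mathcal X(s+u)+\omega(s)-Y^\downarrow(s)+Y^\uparrow(s+(u\wedge\ell)-\ell)$, $u\ge0$, lies in $\bar{\mathbb D}^i$. The one-sided reflection mapping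 is the pointwise infimum $\psi^i(\mathcal X,Y^j,\omega)(t)=\inf\{Y(t):Y\in\Pi^i(\mathcal X,Y^j,\omega)\}$, $t\ge0$. *)

theory Defs
  imports "HOL-Probability.Probability"
begin

text \<open>
  Functions on \<open>[0,\<infinity>)\<close> are modelled by total functions on the reals whose values at negative
  arguments are irrelevant. The exception is the class \<open>controls\<close> below: its members vanish at
  negative times, which makes them determined by their values on \<open>[0,\<infinity>)\<close>.
\<close>

definition paths :: "(real \<Rightarrow> real) set" where
  "paths = {\<omega>. continuous_on {0..} \<omega>}"

definition path_sigma :: "real set \<Rightarrow> (real \<Rightarrow> real) measure" where
  "path_sigma T = sigma paths {{\<omega> \<in> paths. \<omega> s \<in> B} | s B. s \<in> T \<and> B \<in> sets borel}"

abbreviation natural_filtration :: "real \<Rightarrow> (real \<Rightarrow> real) measure" where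
  "natural_filtration t \<equiv> path_sigma {0..t}"

text \<open>\<open>normal_density\<close> takes the mean and the standard deviation.\<close>

definition brownian_law :: "real \<Rightarrow> real \<Rightarrow> (real \<Rightarrow> real) measure \<Rightarrow> bool" where
  "brownian_law \<mu> \<sigma> P \<longleftrightarrow>
     prob_space P \<and> space P = paths \<and> sets P = sets (path_sigma {0..}) \<and>
     (AE \<omega> in P. \<omega> 0 = 0) \<and>
     (\<forall>s t. 0 \<le> s \<and> s < t \<longrightarrow>
        distributed P lborel (\<lambda>\<omega>. \<omega> t - \<omega> s) (normal_density (\<mu> * (t - s)) (\<sigma> * sqrt (t - s))) \<and>
        prob_space.indep_set P (sets (natural_filtration s))
          {{\<omega> \<in> paths. \<omega> t - \<omega> s \<in> B} | B. B \<in> sets borel})"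

text \<open>The analogue for \<open>C\<^sup>2\<close> of the library's \<open>piecewise_C1_differentiable_on\<close>.\<close>

definition piecewise_C2 :: "(real \<Rightarrow> real) \<Rightarrow> bool" where
  "piecewise_C2 h \<longleftrightarrow> continuous_on UNIV h \<and>
     (\<exists>S h'. finite S \<and> (\<forall>x\<in>- S. (h has_real_derivative h' x) (at x)) \<and> h' C1_differentiable_on (- S))"

record inventory_model =
  lead :: real
  disc :: real
  drift :: real
  stdev :: real
  k_up :: real
  k_down :: real
  slope_bound :: real
  hold :: "real \<Rightarrow> real"
  law :: "(real \<Rightarrow> real) measure"

definition admissible_model :: "inventory_model \<Rightarrow> bool" where
  "admissible_model m \<longleftrightarrow>
     lead m > 0 \<and> disc m > 0 \<and> stdev m > 0 \<and> k_up m > 0 \<and> k_down m > 0 \<and> slope_bound m > 0 \<and>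
     (\<forall>x. hold m x \<ge> 0) \<and> hold m 0 = 0 \<and> convex_on UNIV (hold m) \<and> piecewise_C2 (hold m) \<and>
     (\<forall>x d. (hold m has_real_derivative d) (at x) \<longrightarrow> \<bar>d\<bar> \<le> slope_bound m) \<and>
     brownian_law (drift m) (stdev m) (law m)"

definition states :: "inventory_model \<Rightarrow> (real \<Rightarrow> real) set" where
  "states m = {X. (\<forall>t\<ge>0. continuous (at_right t) X) \<and>
                  (\<forall>t>0. \<exists>l. (X \<longlongrightarrow> l) (at_left t)) \<and>
                  mono_on {0..} X \<and> (\<forall>u\<ge>lead m. X u = X (lead m))}"

definition controls :: "(real \<Rightarrow> real) set" where
  "controls = {Y. (\<forall>t<0. Y t = 0) \<and> (\<forall>t\<ge>0. Y t \<ge> 0) \<and> mono_on {0..} Y \<and>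
                  (\<forall>t\<ge>0. continuous (at_right t) Y)}"

definition state_at ::
  "inventory_model \<Rightarrow> (real \<Rightarrow> real) \<Rightarrow> (real \<Rightarrow> real) \<Rightarrow> (real \<Rightarrow> real) \<Rightarrow> (real \<Rightarrow> real) \<Rightarrow> real \<Rightarrow> real \<Rightarrow> real"
where
  "state_at m X \<omega> Yu Yd t = (\<lambda>u. X (t + u) + \<omega> t + Yu (t + min u (lead m) - lead m) - Yd t)"

text \<open>
  The integral of \<open>exp (- \<gamma> t)\<close> against \<open>dY\<close>. Since a control vanishes at negative times, its
  Stieltjes measure is carried by \<open>[0,\<infinity>)\<close> and has an atom of size \<open>Y 0\<close> at \<open>0\<close>.
\<close>

definition discounted :: "inventory_model \<Rightarrow> (real \<Rightarrow> real) \<Rightarrow> ennreal" where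
  "discounted m Y = (\<integral>\<^sup>+t. ennreal (exp (- disc m * t)) \<partial>interval_measure Y)"

type_synonym control_process = "(real \<Rightarrow> real) \<Rightarrow> real \<Rightarrow> real"

definition adapted_control :: "control_process \<Rightarrow> bool" where
  "adapted_control Y \<longleftrightarrow> (\<forall>\<omega>\<in>paths. Y \<omega> \<in> controls) \<and>
     (\<forall>t\<ge>0. (\<lambda>\<omega>. Y \<omega> t) \<in> borel_measurable (natural_filtration t))"

definition policies :: "inventory_model \<Rightarrow> (control_process \<times> control_process) set" where
  "policies m = {(Yu, Yd). adapted_control Yu \<and> adapted_control Yd \<and>
     (\<integral>\<^sup>+\<omega>. (discounted m (Yu \<omega>) + discounted m (Yd \<omega>)) \<partial>law m) < \<infinity>}"

definition policy_cost ::
  "inventory_model \<Rightarrow> (real \<Rightarrow> real) \<Rightarrow> control_process \<times> control_process \<Rightarrow> ennreal" where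
  "policy_cost m X = (\<lambda>(Yu, Yd).
     \<integral>\<^sup>+\<omega>. ((\<integral>\<^sup>+t\<in>{0..}. ennreal (exp (- disc m * t) * hold m (state_at m X \<omega> (Yu \<omega>) (Yd \<omega>) t 0)) \<partial>lborel)
           + (ennreal (k_up m) * discounted m (Yu \<omega>) + ennreal (k_down m) * discounted m (Yd \<omega>)))
       \<partial>law m)"

text \<open>The infimum is finite, because \<open>hold m\<close> grows at most linearly; so \<open>enn2real\<close> loses nothing.\<close>

definition opt_cost :: "inventory_model \<Rightarrow> (real \<Rightarrow> real) \<Rightarrow> real" where
  "opt_cost m X = enn2real (INF \<pi>\<in>policies m. policy_cost m X \<pi>)"

definition adjust :: "inventory_model \<Rightarrow> real \<Rightarrow> real \<Rightarrow> (real \<Rightarrow> real) \<Rightarrow> real \<Rightarrow> real" where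
  "adjust m a b X = (\<lambda>u. X u - b + a * indicator {lead m..} u)"

definition adjusted_cost :: "inventory_model \<Rightarrow> (real \<Rightarrow> real) \<Rightarrow> real \<Rightarrow> real \<Rightarrow> real" where
  "adjusted_cost m X a b = k_up m * a + k_down m * b + opt_cost m (adjust m a b X)"

text \<open>
  Differentiability within \<open>{0..}\<close> is two-sided at positive points and from the right at \<open>0\<close>.
\<close>

definition convex_differentiable_cost :: "inventory_model \<Rightarrow> bool" where
  "convex_differentiable_cost m \<longleftrightarrow> (\<forall>X\<in>states m. \<forall>c\<ge>0.
     convex_on {0..} (\<lambda>a. adjusted_cost m X a c) \<and> (\<lambda>a. adjusted_cost m X a c) differentiable_on {0..} \<and>
     convex_on {0..} (\<lambda>b. adjusted_cost m X c b) \<and> (\<lambda>b. adjusted_cost m X c b) differentiable_on {0..})"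

text \<open>\<open>Sup\<close> and \<open>Inf\<close> in \<open>ereal\<close> give the conventions \<open>max {} = -\<infinity>\<close> and \<open>min {} = \<infinity>\<close>.\<close>

definition w_up :: "inventory_model \<Rightarrow> (real \<Rightarrow> real) \<Rightarrow> real \<Rightarrow> ereal" where
  "w_up m X s = Sup (ereal ` {w.
     ((\<lambda>a. adjusted_cost m (\<lambda>u. X (s + u) + w) a 0) has_real_derivative 0) (at 0 within {0..})})"

definition w_down :: "inventory_model \<Rightarrow> (real \<Rightarrow> real) \<Rightarrow> real \<Rightarrow> ereal" where
  "w_down m X s = Inf (ereal ` {w.
     ((\<lambda>b. adjusted_cost m (\<lambda>u. X (s + u) + w) 0 b) has_real_derivative 0) (at 0 within {0..})})"

definition states_up :: "inventory_model \<Rightarrow> (real \<Rightarrow> real) set" where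
  "states_up m = {X \<in> states m. w_up m X 0 > 0}"

definition states_down :: "inventory_model \<Rightarrow> (real \<Rightarrow> real) set" where
  "states_down m = {X \<in> states m. w_down m X 0 < 0}"

definition feasible_up ::
  "inventory_model \<Rightarrow> (real \<Rightarrow> real) \<Rightarrow> (real \<Rightarrow> real) \<Rightarrow> (real \<Rightarrow> real) \<Rightarrow> (real \<Rightarrow> real) set" where
  "feasible_up m X Yd \<omega> =
     {Yu \<in> controls. \<forall>s\<ge>0. state_at m X \<omega> Yu Yd s \<in> states m - states_up m}"

definition feasible_down ::
  "inventory_model \<Rightarrow> (real \<Rightarrow> real) \<Rightarrow> (real \<Rightarrow> real) \<Rightarrow> (real \<Rightarrow> real) \<Rightarrow> (real \<Rightarrow> real) set" where
  "feasible_down m X Yu \<omega> =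
     {Yd \<in> controls. \<forall>s\<ge>0. state_at m X \<omega> Yu Yd s \<in> states m - states_down m}"

text \<open>
  The infimum is taken in \<open>ereal\<close>, so that it is \<open>\<infinity>\<close>, and not an arbitrary real, when there is no
  feasible control.
\<close>

definition reflect_up ::
  "inventory_model \<Rightarrow> (real \<Rightarrow> real) \<Rightarrow> (real \<Rightarrow> real) \<Rightarrow> (real \<Rightarrow> real) \<Rightarrow> real \<Rightarrow> ereal" where
  "reflect_up m X Yd \<omega> t = (INF Y\<in>feasible_up m X Yd \<omega>. ereal (Y t))"

definition reflect_down ::
  "inventory_model \<Rightarrow> (real \<Rightarrow> real) \<Rightarrow> (real \<Rightarrow> real) \<Rightarrow> (real \<Rightarrow> real) \<Rightarrow> real \<Rightarrow> ereal" where
  "reflect_down m X Yu \<omega> t = (INF Y\<in>feasible_down m X Yu \<omega>. ereal (Y t))"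

definition two_sided_reflection ::
  "inventory_model \<Rightarrow> (real \<Rightarrow> real) \<Rightarrow> (real \<Rightarrow> real) \<Rightarrow> (real \<Rightarrow> real) \<times> (real \<Rightarrow> real) \<Rightarrow> bool" where
  "two_sided_reflection m X \<omega> = (\<lambda>(Yu, Yd). Yu \<in> controls \<and> Yd \<in> controls \<and>
     (\<forall>t\<ge>0. ereal (Yu t) = reflect_up m X Yd \<omega> t) \<and>
     (\<forall>t\<ge>0. ereal (Yd t) = reflect_down m X Yu \<omega> t))"

end

theory Submission
  imports Defs
begin

text \<open>
  An order moves only the part of the state from the lead time on, whereas a downward adjustment
  shifts the whole state. The proof has a stochastic half, about which states call for an
  adjustment, and a pathwise half, about a single path.

  \<^bold>\<open>The action regions.\<close> Record a control problem by its cumulative supply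
  (the initial state plus the orders that have arrived) and its cumulative removal (an arbitrary
  offset plus the downward adjustments). The constraints only say that these two paths increase,
  the proportional costs are linear in them, and the holding cost is a convex function of their
  difference. Hence replacing two such pairs of paths by their pointwise maximum and their
  pointwise minimum does not increase the total cost (\<open>inf_cost_lattice\<close>): the
  optimal cost is submodular, jointly in the state and the offset. Applied to an ordered pair of
  problems, this inequality compares marginal costs. The benefit of ordering shrinks when the
  state is raised at the lead time by at least as much as anywhere else
  (\<open>w_up_mono\<close>), and the need for a downward adjustment shrinks when the state is
  lowered (\<open>w_down_antimono\<close>). A marginal cost is never negative, because an
  adjustment may be made at time \<open>0\<close>; so the monotonicity of marginal costs passes to
  the set where they vanish. Since a state is at most the constant state with the same value at
  the lead time, its inventory position, choosing reals \<open>p < q\<close> between the two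
  thresholds of the zero state gives two barriers: no order is needed above position
  \<open>p\<close> and no downward adjustment below position \<open>q\<close>
  (\<open>two_barriers_of_gap\<close>).

  \<^bold>\<open>Existence.\<close> A larger downward control leaves fewer feasible upward
  controls, and conversely. So the pair of one-sided reflections is a monotone operator on pairs
  of controls, and a pointwise infimum of controls is again a control. As for Tarski's theorem,
  the infimum of all pairs that dominate their image is the least fixed point
  (\<open>ex_least_mutually_minimal\<close>). Such pairs exist, because every continuous path can
  be kept in the band \<open>[p, q]\<close> by the difference of two controls
  (\<open>approx_by_difference_of_controls\<close>).

  \<^bold>\<open>Uniqueness.\<close> Compare a fixed point with the least one at the first time
  where they differ. There the position of the former is above \<open>p\<close> or below
  \<open>q\<close>. In the first case its upward control is not needed, hence constant, near that
  time (\<open>upper_flat\<close>), so both upward controls still agree a little later; and since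
  each one-sided reflection depends only on the past of its argument
  (\<open>lower_causal\<close>), the downward controls agree there as well. The second case is
  symmetric.
\<close>

section \<open>Controls and their pointwise infima\<close>

lemma controls_zero: "Y \<in> controls \<Longrightarrow> t < 0 \<Longrightarrow> Y t = 0"
  by (simp add: controls_def)

lemma controls_nonneg: "Y \<in> controls \<Longrightarrow> 0 \<le> Y t"
  by (cases "t < 0") (auto simp: controls_def)

lemma controls_mono:
  assumes "Y \<in> controls" "s \<le> t"
  shows "Y s \<le> Y t"
proof (cases "s < 0")
  case True
  then show ?thesis using controls_nonneg[OF assms(1), of t] controls_zero[OF assms(1)] by auto
next
  case False
  then show ?thesis using assms unfolding controls_def mono_on_def by auto
qed

lemma controls_right_continuous:
  assumes "Y \<in> controls"
  shows "continuous (at_right t) Y"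
proof (cases "t < 0")
  case True
  have "\<forall>\<^sub>F s in at_right t. Y s = 0"
    unfolding eventually_at_right_field using True controls_zero[OF assms] by auto
  then show ?thesis
    using True controls_zero[OF assms] by (simp add: continuous_within tendsto_eventually)
next
  case False
  then show ?thesis using assms by (auto simp: controls_def)
qed

lemma controlsI:
  assumes "\<And>t. t < 0 \<Longrightarrow> Y t = 0" "\<And>s t. s \<le> t \<Longrightarrow> Y s \<le> Y t"
    and "\<And>t. continuous (at_right t) Y"
  shows "Y \<in> controls"
proof -
  have "0 \<le> Y t" for t
    using assms(2)[of "min (-1) t" t] assms(1)[of "min (-1) t"] by auto
  then show ?thesis using assms by (auto simp: controls_def mono_on_def)
qed

text \<open>
  For nondecreasing functions right-continuity is upper semicontinuity, which infima preserve.
\<close>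
lemma mono_INF_right_continuous:
  fixes f :: "'i \<Rightarrow> real \<Rightarrow> real"
  assumes "I \<noteq> {}"
    and mono: "\<And>i s t. i \<in> I \<Longrightarrow> s \<le> t \<Longrightarrow> f i s \<le> f i t"
    and rc: "\<And>i t. i \<in> I \<Longrightarrow> continuous (at_right t) (f i)"
    and bdd: "\<And>t. bdd_below ((\<lambda>i. f i t) ` I)"
  shows "continuous (at_right t) (\<lambda>t. INF i\<in>I. f i t)"
    and "s \<le> t \<Longrightarrow> (INF i\<in>I. f i s) \<le> (INF i\<in>I. f i t)"
proof -
  show m: "(INF i\<in>I. f i s) \<le> (INF i\<in>I. f i t)" if "s \<le> t" for s t
  proof (rule cINF_mono)
    fix i assume "i \<in> I"
    then show "\<exists>j\<in>I. f j s \<le> f i t" using mono that by blast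
  qed (use assms(1) bdd in auto)
  show "continuous (at_right t) (\<lambda>t. INF i\<in>I. f i t)"
  proof (subst continuous_at_right_real_increasing)
    show "(INF i\<in>I. f i s) \<le> (INF i\<in>I. f i t)" if "s \<le> t" for s t by (rule m[OF that])
    show "\<forall>e>0. \<exists>d>0. (INF i\<in>I. f i (t + d)) - (INF i\<in>I. f i t) < e"
    proof (intro allI impI)
      fix e :: real assume "e > 0"
      then have "(INF i\<in>I. f i t) < (INF i\<in>I. f i t) + e / 2" by simp
      then obtain i where i: "i \<in> I" "f i t < (INF i\<in>I. f i t) + e / 2"
        using assms(1) bdd by (subst (asm) cINF_less_iff) auto
      obtain d where d: "d > 0" "f i (t + d) - f i t < e / 2"
        using rc[OF i(1), of t] continuous_at_right_real_increasing[of "f i" t] mono[OF i(1)] \<open>e > 0\<close>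
        by (metis half_gt_zero)
      have "(INF i\<in>I. f i (t + d)) \<le> f i (t + d)" using i(1) bdd by (intro cINF_lower)
      then show "\<exists>d>0. (INF i\<in>I. f i (t + d)) - (INF i\<in>I. f i t) < e" using d i by (intro exI[of _ d]) auto
    qed
  qed
qed

definition lower_envelope :: "(real \<Rightarrow> real) set \<Rightarrow> real \<Rightarrow> real" where
  "lower_envelope F t = (INF Y\<in>F. Y t)"

lemma bdd_below_controls: "F \<subseteq> controls \<Longrightarrow> bdd_below ((\<lambda>Y. Y t) ` F)"
  by (rule bdd_belowI[of _ 0]) (blast intro: controls_nonneg)

lemma lower_envelope_in_controls:
  assumes "F \<subseteq> controls" "F \<noteq> {}"
  shows "lower_envelope F \<in> controls"
proof -
  have mono: "Y s \<le> Y t" if "Y \<in> F" "s \<le> t" for Y s t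
    by (rule controls_mono[OF subsetD[OF assms(1) that(1)] that(2)])
  have rc: "continuous (at_right t) Y" if "Y \<in> F" for Y t
    by (rule controls_right_continuous[OF subsetD[OF assms(1) that]])
  have "lower_envelope F = (\<lambda>t. INF Y\<in>F. Y t)" by (auto simp: lower_envelope_def)
  moreover have "(\<lambda>t. INF Y\<in>F. Y t) \<in> controls"
  proof (rule controlsI)
    fix t :: real assume "t < 0"
    then have "(\<lambda>Y. Y t) ` F = {0}" using assms(2) controls_zero[OF subsetD[OF assms(1)]]
      by (auto simp: image_def)
    then show "(INF Y\<in>F. Y t) = 0" by simp
  next
    fix s t :: real assume st: "s \<le> t"
    show "(INF Y\<in>F. Y s) \<le> (INF Y\<in>F. Y t)"
      by (rule mono_INF_right_continuous(2)[where f="\<lambda>Y. Y", OF assms(2) _ _ _ st])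
        (fact mono rc bdd_below_controls[OF assms(1)])+
  next
    fix t
    show "continuous (at_right t) (\<lambda>t. INF Y\<in>F. Y t)"
      by (rule mono_INF_right_continuous(1)[where f="\<lambda>Y. Y", OF assms(2)])
        (fact mono rc bdd_below_controls[OF assms(1)])+
  qed
  ultimately show ?thesis by simp
qed

lemma lower_envelope_le: "F \<subseteq> controls \<Longrightarrow> Y \<in> F \<Longrightarrow> lower_envelope F t \<le> Y t"
  unfolding lower_envelope_def using bdd_below_controls by (intro cINF_lower) auto

lemma lower_envelope_greatest:
  "F \<noteq> {} \<Longrightarrow> (\<And>Y. Y \<in> F \<Longrightarrow> c \<le> Y t) \<Longrightarrow> c \<le> lower_envelope F t"
  unfolding lower_envelope_def by (intro cINF_greatest) auto

text \<open>
  The emptiness clause matters: a real infimum over the empty set is an arbitrary number, whereas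
  the extended-real infimum in the reflection maps is then infinite and equals no control.
\<close>
definition is_lower_envelope :: "(real \<Rightarrow> real) set \<Rightarrow> (real \<Rightarrow> real) \<Rightarrow> bool" where
  "is_lower_envelope F Y \<longleftrightarrow> F \<noteq> {} \<and> Y = lower_envelope F"

lemma is_lower_envelope_in_controls: "is_lower_envelope F Y \<Longrightarrow> F \<subseteq> controls \<Longrightarrow> Y \<in> controls"
  using lower_envelope_in_controls by (simp add: is_lower_envelope_def)

lemma is_lower_envelope_le: "F \<subseteq> controls \<Longrightarrow> is_lower_envelope F Y \<Longrightarrow> Z \<in> F \<Longrightarrow> Y t \<le> Z t"
  using lower_envelope_le by (simp add: is_lower_envelope_def)

lemma is_lower_envelope_greatest:
  "is_lower_envelope F Y \<Longrightarrow> (\<And>Z. Z \<in> F \<Longrightarrow> c \<le> Z t) \<Longrightarrow> c \<le> Y t"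
  using lower_envelope_greatest by (simp add: is_lower_envelope_def)

lemma ereal_INF_eq_lower_envelope_iff:
  assumes "F \<subseteq> controls"
  shows "Y \<in> controls \<and> (\<forall>t\<ge>0. ereal (Y t) = (INF Z\<in>F. ereal (Z t))) \<longleftrightarrow> is_lower_envelope F Y"
proof (cases "F = {}")
  case True
  then show ?thesis by (auto simp: top_ereal_def is_lower_envelope_def)
next
  case False
  have inf: "(INF Z\<in>F. ereal (Z t)) = ereal (lower_envelope F t)" for t
    unfolding lower_envelope_def
  proof (subst ereal_Inf')
    show "bdd_below ((\<lambda>Y. Y t) ` F)" using bdd_below_controls[OF assms] .
  qed (use False in \<open>auto simp: image_image\<close>)
  have iff: "(\<forall>t\<ge>0. Y t = lower_envelope F t) \<longleftrightarrow> Y = lower_envelope F" if "Y \<in> controls"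
  proof
    assume "\<forall>t\<ge>0. Y t = lower_envelope F t"
    then have "Y t = lower_envelope F t" for t
      using controls_zero[OF that] controls_zero[OF lower_envelope_in_controls[OF assms False]]
      by (cases "t < 0") auto
    then show "Y = lower_envelope F" by auto
  qed auto
  show ?thesis
    unfolding inf ereal.inject is_lower_envelope_def
    using iff lower_envelope_in_controls[OF assms False] False by blast
qed

section \<open>States\<close>

lemma right_continuous_compose_mono:
  fixes f g :: "real \<Rightarrow> real"
  assumes "continuous (at_right (f t)) g" "continuous (at_right t) f" "\<And>u. t \<le> u \<Longrightarrow> f t \<le> f u"
  shows "continuous (at_right t) (\<lambda>u. g (f u))"
proof -
  have "continuous (at (f t) within insert (f t) {f t<..}) g"
    using assms(1) by (simp add: continuous_within at_within_def)
  then have "continuous (at (f t) within f ` {t<..}) g"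
    by (rule continuous_within_subset) (use assms(3) in \<open>force simp: le_less\<close>)
  then show ?thesis using continuous_within_compose[OF assms(2)] by (simp add: o_def)
qed

lemma mono_on_left_limit:
  fixes f :: "real \<Rightarrow> real"
  assumes "mono_on {0..} f" "t > 0"
  shows "\<exists>l. (f \<longlongrightarrow> l) (at_left t)"
proof -
  let ?l = "SUP s\<in>{0..<t}. f s"
  have bdd: "bdd_above (f ` {0..<t})"
    using assms by (intro bdd_aboveI[of _ "f t"]) (auto simp: mono_on_def)
  have "(f \<longlongrightarrow> ?l) (at_left t)"
  proof (rule increasing_tendsto)
    show "\<forall>\<^sub>F s in at_left t. f s \<le> ?l"
      unfolding eventually_at_left_field using assms(2) bdd by (intro exI[of _ 0]) (auto intro!: cSUP_upper)
    fix x assume "x < ?l"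
    then obtain s where s: "s \<in> {0..<t}" "x < f s"
      using bdd assms(2) by (subst (asm) less_cSUP_iff) auto
    then show "\<forall>\<^sub>F s in at_left t. x < f s"
      unfolding eventually_at_left_field using assms(1)
      by (intro exI[of _ s]) (auto simp: mono_on_def intro: less_le_trans)
  qed
  then show ?thesis by blast
qed

lemma statesI:
  assumes "\<And>t. t \<ge> 0 \<Longrightarrow> continuous (at_right t) X" "mono_on {0..} X" "\<And>u. u \<ge> lead m \<Longrightarrow> X u = X (lead m)"
  shows "X \<in> states m"
  unfolding states_def mem_Collect_eq
  by (intro conjI allI impI assms(1,2,3) mono_on_left_limit[OF assms(2)])

lemma states_mono: "X \<in> states m \<Longrightarrow> 0 \<le> s \<Longrightarrow> s \<le> t \<Longrightarrow> X s \<le> X t"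
  unfolding states_def mem_Collect_eq by (elim conjE) (rule mono_onD, auto)

lemma states_const: "X \<in> states m \<Longrightarrow> lead m \<le> t \<Longrightarrow> X t = X (lead m)"
  unfolding states_def mem_Collect_eq by blast

lemma states_right_continuous: "X \<in> states m \<Longrightarrow> 0 \<le> t \<Longrightarrow> continuous (at_right t) X"
  unfolding states_def mem_Collect_eq by blast

lemma states_le_position: "X \<in> states m \<Longrightarrow> 0 \<le> t \<Longrightarrow> X t \<le> X (lead m)"
  using states_mono[of X m t "lead m"] states_const[of X m t] by (cases "t \<le> lead m") auto

text \<open>
  Controls vanish at negative times and start with a nonnegative jump, so the part of the pipeline
  that is due to orders is increasing and right-continuous as well.
\<close>
lemma state_at_in_states:
  assumes "X \<in> states m" "Yu \<in> controls" "0 \<le> s"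
  shows "state_at m X \<omega> Yu Yd s \<in> states m"
proof (rule statesI)
  fix t :: real assume "0 \<le> t"
  have "continuous (at_right t) (\<lambda>u. X (s + u))"
  proof (rule right_continuous_compose_mono[where f="\<lambda>u. s + u"])
    show "continuous (at_right (s + t)) X"
      using assms(3) \<open>0 \<le> t\<close> by (intro states_right_continuous[OF assms(1)]) simp
  qed (auto intro!: continuous_intros)
  moreover have "continuous (at_right t) (\<lambda>u. Yu (s + min u (lead m) - lead m))"
  proof (rule right_continuous_compose_mono[where f="\<lambda>u. s + min u (lead m) - lead m"])
    show "continuous (at_right (s + min t (lead m) - lead m)) Yu"
      by (rule controls_right_continuous[OF assms(2)])
  qed (auto intro!: continuous_intros continuous_min)
  ultimately show "continuous (at_right t) (state_at m X \<omega> Yu Yd s)"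
    unfolding state_at_def by (intro continuous_intros)
next
  show "mono_on {0..} (state_at m X \<omega> Yu Yd s)"
  proof (rule mono_onI)
    fix u v :: real assume "u \<in> {0..}" "v \<in> {0..}" "u \<le> v"
    then have "X (s + u) \<le> X (s + v)"
      "Yu (s + min u (lead m) - lead m) \<le> Yu (s + min v (lead m) - lead m)"
      using assms(3) states_mono[OF assms(1), of "s + u" "s + v"] by (auto intro: controls_mono[OF assms(2)])
    then show "state_at m X \<omega> Yu Yd s u \<le> state_at m X \<omega> Yu Yd s v"
      unfolding state_at_def by linarith
  qed
next
  fix u assume "lead m \<le> u"
  then show "state_at m X \<omega> Yu Yd s u = state_at m X \<omega> Yu Yd s (lead m)"
    using states_const[OF assms(1), of "s + u"] states_const[OF assms(1), of "s + lead m"] assms(3)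
    by (simp add: state_at_def min_def)
qed

section \<open>Constructing controls\<close>

lemma controls_splice:
  assumes "Y \<in> controls" "Z \<in> controls" and le: "\<And>t. t < b \<Longrightarrow> Y t \<le> Z b"
  shows "(\<lambda>t. if t < b then Y t else Z t) \<in> controls"
proof (rule controlsI)
  fix t
  show "continuous (at_right t) (\<lambda>t. if t < b then Y t else Z t)"
  proof (cases "t < b")
    case True
    have "\<forall>\<^sub>F s in at_right t. Y s = (if s < b then Y s else Z s)"
      unfolding eventually_at_right_field using True by auto
    then show ?thesis using True controls_right_continuous[OF assms(1), of t]
      by (auto simp: continuous_within elim: Lim_transform_eventually)
  next
    case False
    have "\<forall>\<^sub>F s in at_right t. Z s = (if s < b then Y s else Z s)"
      unfolding eventually_at_right_field using False by (intro exI[of _ "t+1"]) auto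
    then show ?thesis using False controls_right_continuous[OF assms(2), of t]
      by (auto simp: continuous_within elim: Lim_transform_eventually)
  qed
next
  fix s t :: real assume "s \<le> t"
  then show "(if s < b then Y s else Z s) \<le> (if t < b then Y t else Z t)"
    using le[of s] controls_mono[OF assms(2), of b t] controls_mono[OF assms(2), of s t]
      controls_mono[OF assms(1), of s t] by auto
next
  show "(if t < b then Y t else Z t) = 0" if "t < 0" for t
    using controls_zero[OF assms(1) that] controls_zero[OF assms(2) that] by simp
qed

lemma zero_in_controls: "(\<lambda>_. 0) \<in> controls"
  by (auto simp: controls_def intro: mono_onI)

lemma controls_add:
  assumes "Y \<in> controls" "Z \<in> controls"
  shows "(\<lambda>t. Y t + Z t) \<in> controls"
proof (rule controlsI)
  show "continuous (at_right t) (\<lambda>t. Y t + Z t)" for t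
    by (intro continuous_add controls_right_continuous assms)
  show "Y s + Z s \<le> Y t + Z t" if "s \<le> t" for s t
    using controls_mono[OF assms(1) that] controls_mono[OF assms(2) that] by (rule add_mono)
next
  show "Y t + Z t = 0" if "t < 0" for t
    using controls_zero[OF assms(1) that] controls_zero[OF assms(2) that] by simp
qed

lemma controls_min_const:
  assumes "Y \<in> controls" "0 \<le> K"
  shows "(\<lambda>t. min (Y t) K) \<in> controls"
proof (rule controlsI)
  fix s t :: real assume "s \<le> t"
  then show "min (Y s) K \<le> min (Y t) K" using controls_mono[OF assms(1), of s t] by auto
next
  show "continuous (at_right t) (\<lambda>t. min (Y t) K)" for t
    by (intro continuous_min controls_right_continuous[OF assms(1)] continuous_const)
next
  show "min (Y t) K = 0" if "t < 0" for t
    using controls_zero[OF assms(1) that] assms(2) by simp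
qed

section \<open>Approximation of continuous paths by differences of controls\<close>

lemma right_nbhd_small:
  assumes "Y \<in> controls" "0 < e"
  obtains d where "0 < d" "\<And>s. s < t + d \<Longrightarrow> Y s < Y t + e"
proof -
  obtain d where "d > 0" "Y (t + d) - Y t < e"
    using controls_right_continuous[OF assms(1), of t] controls_mono[OF assms(1)] assms(2)
      continuous_at_right_real_increasing[of Y t] by blast
  moreover have "Y s < Y t + e" if "s < t + d" for s
    using controls_mono[OF assms(1), of s "t + d"] that calculation(2) by linarith
  ultimately show ?thesis using that by blast
qed

text \<open>
  The bound at \<open>\<tau>\<close> itself forces \<open>Y \<tau> \<le> Y r\<close>, as
  \<open>Y \<tau>\<close> exceeds \<open>Y \<tau> - e\<close>; then the bound is
  \<open>Y r\<close> throughout. This is how a barrier keeps a control from growing, at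
  \<open>\<tau>\<close> by a jump or after it.
\<close>
lemma flat_near:
  fixes Y :: "real \<Rightarrow> real"
  assumes Y: "Y \<in> controls" and e: "0 < e" and r: "r < \<tau>" "\<tau> < b"
    and flat: "\<And>t. r \<le> t \<Longrightarrow> t < b \<Longrightarrow> Y t \<le> max (max 0 (Y \<tau> - e)) (Y r)"
    and t: "r \<le> t" "t < b"
  shows "Y t = Y r"
proof -
  have "Y \<tau> \<le> Y r"
    using flat[of \<tau>] r e controls_nonneg[OF Y, of r] by auto
  then have "Y t \<le> Y r" using flat[OF t] e controls_nonneg[OF Y, of r] by auto
  then show ?thesis using controls_mono[OF Y t(1)] by auto
qed

text \<open>
  Beyond the distance granted by uniform continuity, a large slope dominates the oscillation of
  the function.
\<close>
lemma ex_linear_modulus: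
  fixes g :: "real \<Rightarrow> real"
  assumes g: "continuous_on {0..} g" and e: "0 < e"
  shows "\<exists>H\<ge>0. \<forall>s\<in>{0..T}. \<forall>t\<in>{0..T}. \<bar>g t - g s\<bar> \<le> e + H * \<bar>t - s\<bar>"
proof -
  have c: "continuous_on {0..T} g" using g by (rule continuous_on_subset) auto
  have "uniformly_continuous_on {0..T} g" using c by (rule compact_uniformly_continuous) simp
  then obtain d where d: "0 < d" "\<And>s t. s \<in> {0..T} \<Longrightarrow> t \<in> {0..T} \<Longrightarrow> \<bar>t - s\<bar> < d \<Longrightarrow> \<bar>g t - g s\<bar> < e"
    using e unfolding uniformly_continuous_on_def dist_real_def by metis
  have "bounded (g ` {0..T})" using c by (intro compact_imp_bounded compact_continuous_image) auto
  then obtain G where G: "\<And>s. s \<in> {0..T} \<Longrightarrow> \<bar>g s\<bar> \<le> G" unfolding bounded_iff real_norm_def by blast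
  define H where "H = 2 * \<bar>G\<bar> / d"
  have "\<bar>g t - g s\<bar> \<le> e + H * \<bar>t - s\<bar>" if st: "s \<in> {0..T}" "t \<in> {0..T}" for s t
  proof (cases "\<bar>t - s\<bar> < d")
    case True
    have "0 \<le> H * \<bar>t - s\<bar>" using d(1) by (simp add: H_def)
    then show ?thesis using d(2)[OF st True] by linarith
  next
    case False
    then have "2 * \<bar>G\<bar> * 1 \<le> 2 * \<bar>G\<bar> * (\<bar>t - s\<bar> / d)"
      using d(1) by (intro mult_left_mono) (auto simp: field_simps)
    then have "2 * \<bar>G\<bar> \<le> H * \<bar>t - s\<bar>" by (simp add: H_def)
    moreover have "\<bar>g t - g s\<bar> \<le> 2 * \<bar>G\<bar>" using G[OF st(1)] G[OF st(2)] by linarith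
    ultimately show ?thesis using e by linarith
  qed
  moreover have "0 \<le> H" using d(1) by (simp add: H_def)
  ultimately show ?thesis by blast
qed

text \<open>
  Discarding negative times turns a nondecreasing right-continuous function into a control whose
  jump at \<open>0\<close> is its value there.
\<close>
lemma controls_cut:
  assumes mono: "\<And>s t. s \<le> t \<Longrightarrow> f s \<le> f t" and rc: "\<And>t. continuous (at_right t) f" and "0 \<le> f 0"
  shows "(\<lambda>t. if t < 0 then 0 else f t) \<in> controls"
proof (rule controlsI)
  fix s t :: real assume "s \<le> t"
  then show "(if s < 0 then 0 else f s) \<le> (if t < 0 then 0 else f t)"
    using mono[of s t] mono[of 0 t] assms(3) by auto
next
  fix t
  show "continuous (at_right t) (\<lambda>t. if t < 0 then 0 else f t)"
  proof (cases "t < 0")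
    case True
    have "\<forall>\<^sub>F s in at_right t. 0 = (if s < 0 then 0 else f s)"
      unfolding eventually_at_right_field using True by (intro exI[of _ 0]) auto
    then have "((\<lambda>s. if s < 0 then 0 else f s) \<longlongrightarrow> 0) (at_right t)"
      by (rule Lim_transform_eventually[OF tendsto_const])
    then show ?thesis using True by (simp add: continuous_within)
  next
    case False
    have "\<forall>\<^sub>F s in at_right t. f s = (if s < 0 then 0 else f s)"
      unfolding eventually_at_right_field using False by (intro exI[of _ "t + 1"]) auto
    then have "((\<lambda>s. if s < 0 then 0 else f s) \<longlongrightarrow> f t) (at_right t)"
      using rc[of t] unfolding continuous_within by (rule Lim_transform_eventually[rotated])
    then show ?thesis using False by (simp add: continuous_within)
  qed
qed simp

text \<open>
  The moduli on the intervals \<open>[0, n + 1]\<close> are glued into one nondecreasing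
  function \<open>L\<close>, whose slope increases from one unit interval to the next.
\<close>
lemma ex_control_modulus:
  fixes g :: "real \<Rightarrow> real"
  assumes g: "continuous_on {0..} g" and e: "0 < e"
  shows "\<exists>L\<in>controls. \<forall>s\<ge>0. \<forall>t\<ge>0. \<bar>g t - g s\<bar> \<le> e + \<bar>L t - L s\<bar>"
proof -
  have "\<forall>n. \<exists>H\<ge>0. \<forall>s\<in>{0..real n + 1}. \<forall>t\<in>{0..real n + 1}. \<bar>g t - g s\<bar> \<le> e + H * \<bar>t - s\<bar>"
    using ex_linear_modulus[OF assms] by blast
  then obtain H where H0: "\<And>n. 0 \<le> H n"
    and H: "\<And>n s t. s \<in> {0..real n + 1} \<Longrightarrow> t \<in> {0..real n + 1} \<Longrightarrow> \<bar>g t - g s\<bar> \<le> e + H n * \<bar>t - s\<bar>"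
    by metis
  define c where "c n = (\<Sum>k\<le>n. H k)" for n
  have c0: "0 \<le> c n" for n using H0 by (auto simp: c_def intro: sum_nonneg)
  have c_mono: "c i \<le> c j" if "i \<le> j" for i j
    unfolding c_def using that H0 by (intro sum_mono2) auto
  have H_le: "H n \<le> c n" for n
    unfolding c_def using H0 by (intro member_le_sum) auto
  define L0 where "L0 t = max t 0 * c (nat \<lfloor>t\<rfloor>)" for t :: real
  have L0_diff: "(t - s) * c (nat \<lfloor>t\<rfloor>) \<le> L0 t - L0 s" if "0 \<le> s" "s \<le> t" for s t
  proof -
    have "s * c (nat \<lfloor>s\<rfloor>) \<le> s * c (nat \<lfloor>t\<rfloor>)"
      using that by (intro mult_left_mono c_mono nat_mono floor_mono) auto
    then show ?thesis using that by (simp add: L0_def algebra_simps)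
  qed
  have L0_mono: "L0 s \<le> L0 t" if "s \<le> t" for s t
    unfolding L0_def using that c0 by (intro mult_mono c_mono nat_mono floor_mono) auto
  have L0_rc: "continuous (at_right t) L0" for t
  proof -
    have "\<forall>\<^sub>F s in at_right t. max s 0 * c (nat \<lfloor>t\<rfloor>) = L0 s"
      unfolding eventually_at_right_field
    proof (intro exI[of _ "of_int \<lfloor>t\<rfloor> + 1"] conjI allI impI)
      fix s assume "t < s" "s < of_int \<lfloor>t\<rfloor> + 1"
      then have "\<lfloor>s\<rfloor> = \<lfloor>t\<rfloor>" by linarith
      then show "max s 0 * c (nat \<lfloor>t\<rfloor>) = L0 s" by (simp add: L0_def)
    qed linarith
    moreover have "((\<lambda>s. max s 0 * c (nat \<lfloor>t\<rfloor>)) \<longlongrightarrow> L0 t) (at_right t)"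
      unfolding L0_def by (intro tendsto_intros)
    ultimately show ?thesis unfolding continuous_within by (rule Lim_transform_eventually[rotated])
  qed
  define L where "L t = (if t < 0 then 0 else L0 t)" for t
  have "L \<in> controls"
    unfolding L_def
  proof (rule controls_cut[OF _ L0_rc])
    show "0 \<le> L0 0" by (simp add: L0_def)
  qed (rule L0_mono)
  moreover have le: "\<bar>g t - g s\<bar> \<le> e + \<bar>L t - L s\<bar>" if st: "0 \<le> s" "s \<le> t" for s t
  proof -
    define n where "n = nat \<lfloor>t\<rfloor>"
    have "t \<le> real n + 1" using st unfolding n_def by linarith
    then have "\<bar>g t - g s\<bar> \<le> e + H n * \<bar>t - s\<bar>" using st by (intro H) auto
    also have "H n * \<bar>t - s\<bar> \<le> c n * \<bar>t - s\<bar>" by (intro mult_right_mono H_le) auto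
    also have "c n * \<bar>t - s\<bar> \<le> L0 t - L0 s"
      using L0_diff[OF st] st unfolding n_def by (simp add: mult.commute)
    finally show ?thesis using st by (simp add: L_def)
  qed
  moreover have "\<bar>g t - g s\<bar> \<le> e + \<bar>L t - L s\<bar>" if "0 \<le> s" "0 \<le> t" for s t
    using le[of s t] le[of t s] that by (cases "s \<le> t") (auto simp: abs_minus_commute)
  ultimately show ?thesis by blast
qed

text \<open>
  The inf-convolution of \<open>g\<close> with the distance
  \<open>\<bar>L t - L s\<bar>\<close> stays within \<open>e\<close> below \<open>g\<close>.
  Adding \<open>L\<close> to it makes it nondecreasing, since every function
  \<open>\<bar>L t - L s\<bar> + L t\<close> of \<open>t\<close> is nondecreasing. Any kind
  of function of bounded variation would do; this one avoids positive and negative variations.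
\<close>
lemma approx_by_difference_of_controls:
  fixes g :: "real \<Rightarrow> real"
  assumes g: "continuous_on {0..} g" and e: "0 < e"
  shows "\<exists>A\<in>controls. \<exists>B\<in>controls. \<forall>t\<ge>0. g t - e \<le> A t - B t \<and> A t - B t \<le> g t"
proof -
  obtain L where L: "L \<in> controls"
    and mod: "\<And>s t. 0 \<le> s \<Longrightarrow> 0 \<le> t \<Longrightarrow> \<bar>g t - g s\<bar> \<le> e + \<bar>L t - L s\<bar>"
    using ex_control_modulus[OF assms] by blast
  define f where "f s t = g s + \<bar>L t - L s\<bar> + L t" for s t
  have f_ge: "g (max 0 t) - e + L (max 0 t) \<le> f s t" if t: "0 \<le> s" "0 \<le> t" for s t
    using mod[OF t] t by (simp add: f_def)
  have f_neg: "f s t = g s + L s" if "t < 0" for s t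
    using controls_zero[OF L that] controls_nonneg[OF L, of s] by (simp add: f_def)
  have bdd: "bdd_below ((\<lambda>s. f s t) ` {0..})" for t
  proof (cases "t < 0")
    case True
    have "g 0 - e \<le> f s t" if "0 \<le> s" for s
      using mod[of s 0] that f_neg[OF True] controls_nonneg[OF L, of 0] controls_mono[OF L that] by auto
    then show ?thesis by (intro bdd_belowI[of _ "g 0 - e"]) auto
  next
    case False
    then show ?thesis using f_ge by (intro bdd_belowI[of _ "g (max 0 t) - e + L (max 0 t)"]) auto
  qed
  have f_mono: "f s t \<le> f s t'" if "t \<le> t'" for s t t'
    using controls_mono[OF L that] by (simp add: f_def)
  have f_rc: "continuous (at_right t) (f s)" for s t
    unfolding f_def by (intro continuous_intros controls_right_continuous[OF L])
  define a where "a t = (INF s\<in>{0..}. f s t)" for t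
  have a_mono: "a s \<le> a t" if "s \<le> t" for s t
    unfolding a_def by (rule mono_INF_right_continuous(2)[OF _ f_mono f_rc bdd that]) auto
  have a_rc: "continuous (at_right t) a" for t
    unfolding a_def by (rule mono_INF_right_continuous(1)[OF _ f_mono f_rc bdd]) auto
  have a_ge: "g t - e + L t \<le> a t" if "0 \<le> t" for t
    unfolding a_def using f_ge that by (intro cINF_greatest) auto
  have a_le: "a t \<le> g t + L t" if "0 \<le> t" for t
    unfolding a_def using that by (intro cINF_lower2[OF bdd, of t]) (auto simp: f_def)
  \<comment> \<open>Adding \<open>C\<close> to both functions makes them nonnegative at \<open>0\<close> and cancels in their difference.\<close>
  define C where "C = \<bar>g 0\<bar> + e"
  have "0 \<le> C + a 0" using a_ge[of 0] controls_nonneg[OF L, of 0] by (simp add: C_def)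
  define A where "A t = (if t < 0 then 0 else C + a t)" for t
  define B where "B t = (if t < 0 then 0 else C + L t)" for t
  have "A \<in> controls"
    unfolding A_def using \<open>0 \<le> C + a 0\<close>
    by (intro controls_cut add_left_mono a_mono continuous_add continuous_const a_rc)
  moreover have "B \<in> controls"
    unfolding B_def using controls_nonneg[OF L, of 0] e
    by (intro controls_cut add_left_mono controls_mono[OF L] continuous_add continuous_const
        controls_right_continuous[OF L]) (auto simp: C_def)
  moreover have "\<forall>t\<ge>0. g t - e \<le> A t - B t \<and> A t - B t \<le> g t"
  proof (intro allI impI)
    fix t :: real assume "0 \<le> t"
    then show "g t - e \<le> A t - B t \<and> A t - B t \<le> g t"
      using a_ge[of t] a_le[of t] by (simp add: A_def B_def)
  qed
  ultimately show ?thesis by (intro bexI[of _ A] bexI[of _ B])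
qed

section \<open>Two-sided reflection between two barriers\<close>

text \<open>
  What the pathwise argument uses about the model. In \<open>not_up_mono\<close> the new state is
  higher at the lead time, and it exceeds the old one nowhere by more than there: additional
  inventory that arrives earlier may be removed meanwhile, and so it may increase the need to
  order. Writing the position of a state for its value at the lead time, no order is needed at
  positions above \<open>p\<close>, and no downward adjustment at positions below
  \<open>q\<close>.
\<close>
locale two_barriers =
  fixes m :: inventory_model and p q :: real
  assumes lead_pos: "0 < lead m" and gap: "p < q"
    and not_up_if_high: "\<And>X. X \<in> states m \<Longrightarrow> p \<le> X (lead m) \<Longrightarrow> X \<notin> states_up m"
    and not_down_if_low: "\<And>X. X \<in> states m \<Longrightarrow> X (lead m) \<le> q \<Longrightarrow> X \<notin> states_down m"
    and not_up_mono: "\<And>X X'. X \<in> states m \<Longrightarrow> X' \<in> states m \<Longrightarrow> X \<notin> states_up m \<Longrightarrow>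
      X (lead m) \<le> X' (lead m) \<Longrightarrow> (\<And>u. 0 \<le> u \<Longrightarrow> X' u - X u \<le> X' (lead m) - X (lead m)) \<Longrightarrow>
      X' \<notin> states_up m"
    and not_down_mono: "\<And>X X'. X \<in> states m \<Longrightarrow> X' \<in> states m \<Longrightarrow> X \<notin> states_down m \<Longrightarrow>
      (\<And>u. 0 \<le> u \<Longrightarrow> X' u \<le> X u) \<Longrightarrow> X' \<notin> states_down m"
begin

context
  fixes X \<omega> :: "real \<Rightarrow> real"
  assumes X: "X \<in> states m" and \<omega>: "continuous_on {0..} \<omega>"
begin

abbreviation "feas_up B \<equiv> feasible_up m X B \<omega>"
abbreviation "feas_down A \<equiv> feasible_down m X A \<omega>"

lemma feas_up_subset: "feas_up B \<subseteq> controls" by (auto simp: feasible_up_def)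
lemma feas_down_subset: "feas_down A \<subseteq> controls" by (auto simp: feasible_down_def)

lemma state_at_position:
  "0 \<le> s \<Longrightarrow> state_at m X \<omega> A B s (lead m) = X (lead m) + \<omega> s + A s - B s"
  using states_const[OF X, of "s + lead m"] by (simp add: state_at_def)

lemma feasible_upI:
  assumes "Y \<in> controls"
    and "\<And>s. 0 \<le> s \<Longrightarrow> state_at m X \<omega> Y B s \<notin> states_up m \<or> p \<le> X (lead m) + \<omega> s + Y s - B s"
  shows "Y \<in> feas_up B"
proof -
  have "state_at m X \<omega> Y B s \<in> states m - states_up m" if "0 \<le> s" for s
    using assms(2)[OF that] state_at_in_states[OF X assms(1) that, of \<omega> B]
      not_up_if_high[of "state_at m X \<omega> Y B s"] state_at_position[OF that, of Y B] by auto
  then show ?thesis using assms(1) by (auto simp: feasible_up_def)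
qed

lemma feasible_downI:
  assumes "A \<in> controls" "Y \<in> controls"
    and "\<And>s. 0 \<le> s \<Longrightarrow> state_at m X \<omega> A Y s \<notin> states_down m \<or> X (lead m) + \<omega> s + A s - Y s \<le> q"
  shows "Y \<in> feas_down A"
proof -
  have "state_at m X \<omega> A Y s \<in> states m - states_down m" if "0 \<le> s" for s
    using assms(3)[OF that] state_at_in_states[OF X assms(1) that, of \<omega> Y]
      not_down_if_low[of "state_at m X \<omega> A Y s"] state_at_position[OF that, of A Y] by auto
  then show ?thesis using assms(2) by (auto simp: feasible_down_def)
qed

text \<open>
  The tool for building feasible upward controls: at each time, the new state is either above the
  barrier or better than the old one. The new state is better as soon as the net adjustment has
  not decreased and the change of the order process up to that time is largest at that time,
  because earlier orders reach the state before the lead time.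
\<close>
lemma feasible_up_transfer:
  assumes Y0: "Y0 \<in> feas_up B" and Y: "Y \<in> controls"
    and dom: "\<And>s. 0 \<le> s \<Longrightarrow>
      Y0 s - B s \<le> Y s - B' s \<and> (\<forall>r\<le>s. Y r - Y0 r \<le> Y s - Y0 s) \<or>
      p \<le> X (lead m) + \<omega> s + Y s - B' s"
  shows "Y \<in> feas_up B'"
proof (rule feasible_upI[OF Y])
  fix s :: real assume s: "0 \<le> s"
  show "state_at m X \<omega> Y B' s \<notin> states_up m \<or> p \<le> X (lead m) + \<omega> s + Y s - B' s"
    using dom[OF s]
  proof
    assume d: "Y0 s - B s \<le> Y s - B' s \<and> (\<forall>r\<le>s. Y r - Y0 r \<le> Y s - Y0 s)"
    have Y0c: "Y0 \<in> controls" using Y0 feas_up_subset by auto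
    have "state_at m X \<omega> Y0 B s \<notin> states_up m" using Y0 s by (auto simp: feasible_up_def)
    moreover have "state_at m X \<omega> Y0 B s (lead m) \<le> state_at m X \<omega> Y B' s (lead m)"
      using d[THEN conjunct1] unfolding state_at_position[OF s] by linarith
    moreover have "state_at m X \<omega> Y B' s u - state_at m X \<omega> Y0 B s u
        \<le> state_at m X \<omega> Y B' s (lead m) - state_at m X \<omega> Y0 B s (lead m)" if "0 \<le> u" for u
    proof -
      have "s + min u (lead m) - lead m \<le> s" by simp
      from d[THEN conjunct2, rule_format, OF this] show ?thesis
        unfolding state_at_position[OF s] unfolding state_at_def by linarith
    qed
    ultimately have "state_at m X \<omega> Y B' s \<notin> states_up m"
      by (intro not_up_mono[OF state_at_in_states[OF X Y0c s] state_at_in_states[OF X Y s]])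
    then show ?thesis ..
  next
    assume "p \<le> X (lead m) + \<omega> s + Y s - B' s"
    then show ?thesis ..
  qed
qed

text \<open>
  The analogue for downward controls, where a pointwise lower state is better.
\<close>
lemma feasible_down_transfer:
  assumes A: "A \<in> controls" "A' \<in> controls"
    and Y0: "Y0 \<in> feas_down A" and Y: "Y \<in> controls"
    and dom: "\<And>s. 0 \<le> s \<Longrightarrow>
      (\<forall>r\<le>s. A' r - Y s \<le> A r - Y0 s) \<or> X (lead m) + \<omega> s + A' s - Y s \<le> q"
  shows "Y \<in> feas_down A'"
proof (rule feasible_downI[OF A(2) Y])
  fix s :: real assume s: "0 \<le> s"
  show "state_at m X \<omega> A' Y s \<notin> states_down m \<or> X (lead m) + \<omega> s + A' s - Y s \<le> q"
    using dom[OF s]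
  proof
    assume d: "\<forall>r\<le>s. A' r - Y s \<le> A r - Y0 s"
    have "state_at m X \<omega> A Y0 s \<notin> states_down m" using Y0 s by (auto simp: feasible_down_def)
    moreover have "state_at m X \<omega> A' Y s u \<le> state_at m X \<omega> A Y0 s u" if "0 \<le> u" for u
    proof -
      have "s + min u (lead m) - lead m \<le> s" by simp
      from d[rule_format, OF this] show ?thesis unfolding state_at_def by linarith
    qed
    ultimately have "state_at m X \<omega> A' Y s \<notin> states_down m"
      by (intro not_down_mono[OF state_at_in_states[OF X A(1) s] state_at_in_states[OF X A(2) s]])
    then show ?thesis ..
  next
    assume "X (lead m) + \<omega> s + A' s - Y s \<le> q"
    then show ?thesis ..
  qed
qed

lemma feas_up_antimono:
  assumes "\<And>t. B t \<le> B' t"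
  shows "feas_up B' \<subseteq> feas_up B"
proof
  fix Y assume Y: "Y \<in> feas_up B'"
  show "Y \<in> feas_up B"
  proof (rule feasible_up_transfer[OF Y])
    show "Y \<in> controls" using Y feas_up_subset by blast
  qed (use assms in simp)
qed

lemma feas_down_antimono:
  assumes "A \<in> controls" "A' \<in> controls" "\<And>t. A t \<le> A' t"
  shows "feas_down A' \<subseteq> feas_down A"
proof
  fix Y assume Y: "Y \<in> feas_down A'"
  show "Y \<in> feas_down A"
  proof (rule feasible_down_transfer[OF assms(2,1) Y])
    show "Y \<in> controls" using Y feas_down_subset by blast
  qed (use assms(3) in simp)
qed

text \<open>
  The fixed points of the pair of one-sided reflections, without extended reals.
\<close>
definition mutually_minimal :: "(real \<Rightarrow> real) \<Rightarrow> (real \<Rightarrow> real) \<Rightarrow> bool" where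
  "mutually_minimal A B \<longleftrightarrow> is_lower_envelope (feas_up B) A \<and> is_lower_envelope (feas_down A) B"

lemma mutually_minimal_controls:
  assumes "mutually_minimal A B" shows "A \<in> controls" "B \<in> controls"
  using assms is_lower_envelope_in_controls feas_up_subset feas_down_subset unfolding mutually_minimal_def by blast+

lemma mutually_minimal_up_le: "mutually_minimal A B \<Longrightarrow> Y \<in> feas_up B \<Longrightarrow> A t \<le> Y t"
  unfolding mutually_minimal_def by (blast intro: is_lower_envelope_le[OF feas_up_subset])

lemma mutually_minimal_down_le: "mutually_minimal A B \<Longrightarrow> Y \<in> feas_down A \<Longrightarrow> B t \<le> Y t"
  unfolding mutually_minimal_def by (blast intro: is_lower_envelope_le[OF feas_down_subset])

lemma mutually_minimal_up_greatest: "mutually_minimal A B \<Longrightarrow> (\<And>Y. Y \<in> feas_up B \<Longrightarrow> c \<le> Y t) \<Longrightarrow> c \<le> A t"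
  unfolding mutually_minimal_def by (blast intro: is_lower_envelope_greatest)

lemma mutually_minimal_down_greatest: "mutually_minimal A B \<Longrightarrow> (\<And>Y. Y \<in> feas_down A \<Longrightarrow> c \<le> Y t) \<Longrightarrow> c \<le> B t"
  unfolding mutually_minimal_def by (blast intro: is_lower_envelope_greatest)

lemma two_sided_reflection_iff: "two_sided_reflection m X \<omega> (A, B) \<longleftrightarrow> mutually_minimal A B"
  unfolding two_sided_reflection_def reflect_up_def reflect_down_def mutually_minimal_def prod.case
    ereal_INF_eq_lower_envelope_iff[OF feas_up_subset, symmetric] ereal_INF_eq_lower_envelope_iff[OF feas_down_subset, symmetric]
  by blast

lemma ex_band_controls:
  "\<exists>A\<in>controls. \<exists>B\<in>controls. \<forall>s\<ge>0. X (lead m) + \<omega> s + A s - B s \<in> {p..q}"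
proof -
  have "continuous_on {0..} (\<lambda>s. q - X (lead m) - \<omega> s)" using \<omega> by (intro continuous_intros)
  from approx_by_difference_of_controls[OF this, of "q - p"] gap
  obtain A B where AB: "A \<in> controls" "B \<in> controls"
    "\<And>s. 0 \<le> s \<Longrightarrow> q - X (lead m) - \<omega> s - (q - p) \<le> A s - B s \<and> A s - B s \<le> q - X (lead m) - \<omega> s"
    by auto
  have "X (lead m) + \<omega> s + A s - B s \<in> {p..q}" if "0 \<le> s" for s
    using AB(3)[OF that] unfolding atLeastAtMost_iff by linarith
  then show ?thesis using AB by blast
qed

text \<open>
  The fixed-point argument for the monotone operator formed by the two reflections, applied to the
  pairs \<open>pre\<close> that dominate their own image. Monotonicity holds because the feasible
  sets depend antitonically on the other control; the argument is about infima throughout, so the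
  least pair need not be feasible.
\<close>
lemma ex_least_mutually_minimal:
  "\<exists>A B. mutually_minimal A B \<and>
    (\<forall>A' B'. mutually_minimal A' B' \<longrightarrow> (\<forall>t. A t \<le> A' t) \<and> (\<forall>t. B t \<le> B' t))"
proof -
  define pre where "pre = {(A, B). A \<in> controls \<and> B \<in> controls \<and> feas_up B \<noteq> {} \<and> feas_down A \<noteq> {} \<and>
    (\<forall>t. lower_envelope (feas_up B) t \<le> A t) \<and> (\<forall>t. lower_envelope (feas_down A) t \<le> B t)}"
  have pre_ne: "pre \<noteq> {}"
  proof -
    obtain A B where AB: "A \<in> controls" "B \<in> controls"
      "\<forall>s\<ge>0. X (lead m) + \<omega> s + A s - B s \<in> {p..q}"
      using ex_band_controls by blast
    have "A \<in> feas_up B" "B \<in> feas_down A" using AB by (auto intro!: feasible_upI feasible_downI)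
    then have "(A, B) \<in> pre"
      using AB lower_envelope_le[OF feas_up_subset] lower_envelope_le[OF feas_down_subset] by (auto simp: pre_def)
    then show ?thesis by auto
  qed
  define A B where "A = lower_envelope (fst ` pre)" and "B = lower_envelope (snd ` pre)"
  have sub: "fst ` pre \<subseteq> controls" "snd ` pre \<subseteq> controls" by (auto simp: pre_def)
  have A: "A \<in> controls" and B: "B \<in> controls"
    unfolding A_def B_def using sub pre_ne by (auto intro!: lower_envelope_in_controls)
  have A_le: "A t \<le> A' t" and B_le: "B t \<le> B' t" if "(A', B') \<in> pre" for A' B' t
  proof -
    have "A' \<in> fst ` pre" "B' \<in> snd ` pre" using that by force+
    then have "lower_envelope (fst ` pre) t \<le> A' t" "lower_envelope (snd ` pre) t \<le> B' t"
      using lower_envelope_le[OF sub(1)] lower_envelope_le[OF sub(2)] by blast+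
    then show "A t \<le> A' t" "B t \<le> B' t" unfolding A_def B_def .
  qed
  have FUB: "feas_up B' \<subseteq> feas_up B" and FDA: "feas_down A' \<subseteq> feas_down A" if "(A', B') \<in> pre" for A' B'
  proof -
    show "feas_up B' \<subseteq> feas_up B" by (rule feas_up_antimono) (rule B_le[OF that])
    have "A' \<in> controls" using that by (simp add: pre_def)
    then show "feas_down A' \<subseteq> feas_down A" by (intro feas_down_antimono A A_le[OF that])
  qed
  have ne: "feas_up B \<noteq> {}" "feas_down A \<noteq> {}"
    using pre_ne FUB FDA by (auto simp: pre_def) blast+
  define A1 B1 where "A1 = lower_envelope (feas_up B)" and "B1 = lower_envelope (feas_down A)"
  have A1: "A1 \<in> controls" and B1: "B1 \<in> controls"
    unfolding A1_def B1_def using ne feas_up_subset feas_down_subset by (auto intro!: lower_envelope_in_controls)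
  have mono: "lower_envelope F' t \<le> lower_envelope F t" if "F \<subseteq> F'" "F \<noteq> {}" "F' \<subseteq> controls" for F F' t
    using that lower_envelope_le[OF that(3)] by (intro lower_envelope_greatest) auto
  have A1_le: "A1 t \<le> A t" for t
  proof -
    have "A1 t \<le> A' t" if "(A', B') \<in> pre" for A' B'
    proof -
      have "feas_up B' \<noteq> {}" "lower_envelope (feas_up B') t \<le> A' t" using that by (auto simp: pre_def)
      then show ?thesis unfolding A1_def using mono[OF FUB[OF that] _ feas_up_subset, of t] by linarith
    qed
    then show ?thesis unfolding A_def using pre_ne by (intro lower_envelope_greatest) auto
  qed
  have B1_le: "B1 t \<le> B t" for t
  proof -
    have "B1 t \<le> B' t" if "(A', B') \<in> pre" for A' B'
    proof -
      have "feas_down A' \<noteq> {}" "lower_envelope (feas_down A') t \<le> B' t" using that by (auto simp: pre_def)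
      then show ?thesis unfolding B1_def using mono[OF FDA[OF that] _ feas_down_subset, of t] by linarith
    qed
    then show ?thesis unfolding B_def using pre_ne by (intro lower_envelope_greatest) auto
  qed
  have sub1: "feas_up B \<subseteq> feas_up B1" "feas_down A \<subseteq> feas_down A1"
    by (intro feas_up_antimono feas_down_antimono A1 A A1_le B1_le)+
  have "(A1, B1) \<in> pre"
    using A1 B1 ne sub1 mono[OF sub1(1) ne(1) feas_up_subset] mono[OF sub1(2) ne(2) feas_down_subset]
    unfolding pre_def A1_def[symmetric] B1_def[symmetric] by auto
  from A_le[OF this] B_le[OF this] have "A = A1" "B = B1"
    using A1_le B1_le by (auto intro!: ext antisym)
  then have "mutually_minimal A B"
    using ne A1_def B1_def unfolding mutually_minimal_def is_lower_envelope_def by metis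
  moreover have "(A', B') \<in> pre" if "mutually_minimal A' B'" for A' B'
    using that mutually_minimal_controls[OF that] unfolding mutually_minimal_def is_lower_envelope_def pre_def mem_Collect_eq prod.case
    by (metis order_refl)
  ultimately show ?thesis using A_le B_le by blast
qed

text \<open>
  If the level \<open>K\<close> suffices to keep the position above \<open>p\<close> on
  \<open>[r, b)\<close>, then capping any feasible control there at \<open>K\<close>, or at its
  value at \<open>r\<close> if that is larger, leaves it feasible: where the cap acts the position
  is high, and elsewhere only earlier orders have been reduced. The cap is lifted at
  \<open>b\<close>, so the states after \<open>b\<close> also change only through earlier orders.
\<close>
lemma upper_flat:
  assumes "mutually_minimal A B" "0 \<le> K"
    and slack: "\<And>s. 0 \<le> s \<Longrightarrow> r \<le> s \<Longrightarrow> s < b \<Longrightarrow> p \<le> X (lead m) + \<omega> s + K - B s"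
    and t: "r \<le> t" "t < b"
  shows "A t \<le> max K (A r)"
proof -
  have "A t \<le> max K (Y0 r)" if Y0: "Y0 \<in> feas_up B" for Y0
  proof -
    define Y where "Y s = (if s < b then min (Y0 s) (max K (Y0 r)) else Y0 s)" for s
    have Y0c: "Y0 \<in> controls" using Y0 feas_up_subset by auto
    have le: "Y s \<le> Y0 s" for s by (auto simp: Y_def)
    have "Y \<in> controls"
      unfolding Y_def
    proof (intro controls_splice controls_min_const Y0c)
      fix t assume "t < b"
      then show "min (Y0 t) (max K (Y0 r)) \<le> Y0 b" using controls_mono[OF Y0c, of t b] by auto
    qed (use assms(2) in auto)
    then have "Y \<in> feas_up B"
    proof (rule feasible_up_transfer[OF Y0])
      fix s :: real assume s: "0 \<le> s"
      show "Y0 s - B s \<le> Y s - B s \<and> (\<forall>r\<le>s. Y r - Y0 r \<le> Y s - Y0 s) \<or>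
          p \<le> X (lead m) + \<omega> s + Y s - B s"
      proof (cases "Y s = Y0 s")
        case False
        then have "s < b" "K \<le> Y s" by (auto simp: Y_def split: if_splits)
        moreover have "r \<le> s"
          using False controls_mono[OF Y0c, of s r] by (cases "s \<le> r") (auto simp: Y_def split: if_splits)
        ultimately show ?thesis using slack[OF s] by force
      qed (use le in auto)
    qed
    then have "A t \<le> Y t" by (rule mutually_minimal_up_le[OF assms(1)])
    then show ?thesis using t by (auto simp: Y_def)
  qed
  then have "A t \<le> A r" if "K < A t"
    using that by (intro mutually_minimal_up_greatest[OF assms(1)]) (force simp: le_max_iff_disj)
  then show ?thesis by fastforce
qed

lemma lower_flat:
  assumes "mutually_minimal A B" "0 \<le> K"
    and slack: "\<And>s. 0 \<le> s \<Longrightarrow> r \<le> s \<Longrightarrow> s < b \<Longrightarrow> X (lead m) + \<omega> s + A s - K \<le> q"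
    and t: "r \<le> t" "t < b"
  shows "B t \<le> max K (B r)"
proof -
  have A: "A \<in> controls" by (rule mutually_minimal_controls(1)[OF assms(1)])
  have "B t \<le> max K (Y0 r)" if Y0: "Y0 \<in> feas_down A" for Y0
  proof -
    define Y where "Y s = (if s < b then min (Y0 s) (max K (Y0 r)) else Y0 s)" for s
    have Y0c: "Y0 \<in> controls" using Y0 feas_down_subset by auto
    have "Y \<in> controls"
      unfolding Y_def
    proof (intro controls_splice controls_min_const Y0c)
      fix t assume "t < b"
      then show "min (Y0 t) (max K (Y0 r)) \<le> Y0 b" using controls_mono[OF Y0c, of t b] by auto
    qed (use assms(2) in auto)
    then have "Y \<in> feas_down A"
    proof (rule feasible_down_transfer[OF A A Y0])
      fix s :: real assume s: "0 \<le> s"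
      show "(\<forall>r\<le>s. A r - Y s \<le> A r - Y0 s) \<or> X (lead m) + \<omega> s + A s - Y s \<le> q"
      proof (cases "Y s = Y0 s")
        case False
        then have "s < b" "K \<le> Y s" by (auto simp: Y_def split: if_splits)
        moreover have "r \<le> s"
          using False controls_mono[OF Y0c, of s r] by (cases "s \<le> r") (auto simp: Y_def split: if_splits)
        ultimately show ?thesis using slack[OF s] by force
      qed auto
    qed
    then have "B t \<le> Y t" by (rule mutually_minimal_down_le[OF assms(1)])
    then show ?thesis using t by (auto simp: Y_def)
  qed
  then have "B t \<le> B r" if "K < B t"
    using that by (intro mutually_minimal_down_greatest[OF assms(1)]) (force simp: le_max_iff_disj)
  then show ?thesis by fastforce
qed

text \<open>
  A one-sided reflection depends only on the past of the other control: changing that control from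
  time \<open>b\<close> on can be compensated by an additional jump at \<open>b\<close> and later
  increases.
\<close>
lemma upper_causal:
  assumes "mutually_minimal A B" "mutually_minimal A' B'" and eq: "\<And>t. t < b \<Longrightarrow> B' t = B t" and "t < b"
  shows "A' t \<le> A t"
proof -
  have c: "B \<in> controls" "B' \<in> controls"
    using mutually_minimal_controls assms(1,2) by auto
  have "A' t \<le> Y0 t" if Y0: "Y0 \<in> feas_up B" for Y0
  proof -
    \<comment> \<open>The extra order from \<open>b\<close> on outweighs the whole of \<open>B'\<close> and is nondecreasing.\<close>
    define Y where "Y s = Y0 s + (if s < b then 0 else B' s)" for s
    have "Y \<in> controls" unfolding Y_def
      using Y0 feas_up_subset c(2) controls_nonneg[OF c(2), of b]
      by (intro controls_add controls_splice zero_in_controls) blast+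
    then have "Y \<in> feas_up B'"
    proof (rule feasible_up_transfer[OF Y0])
      fix s :: real assume "0 \<le> s"
      show "Y0 s - B s \<le> Y s - B' s \<and> (\<forall>r\<le>s. Y r - Y0 r \<le> Y s - Y0 s) \<or>
          p \<le> X (lead m) + \<omega> s + Y s - B' s"
      proof -
        have "Y r - Y0 r \<le> Y s - Y0 s" if "r \<le> s" for r
          using that controls_nonneg[OF c(2), of s] controls_mono[OF c(2) that] by (auto simp: Y_def)
        then show ?thesis using eq[of s] controls_nonneg[OF c(1), of s] by (auto simp: Y_def)
      qed
    qed
    then have "A' t \<le> Y t" by (rule mutually_minimal_up_le[OF assms(2)])
    then show ?thesis using assms(4) by (simp add: Y_def)
  qed
  then show ?thesis by (rule mutually_minimal_up_greatest[OF assms(1)])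
qed

lemma lower_causal:
  assumes "mutually_minimal A B" "mutually_minimal A' B'" and eq: "\<And>t. t < b \<Longrightarrow> A' t = A t" and "t < b"
  shows "B' t \<le> B t"
proof -
  have c: "A \<in> controls" "A' \<in> controls"
    using mutually_minimal_controls assms(1,2) by auto
  have "B' t \<le> Y0 t" if Y0: "Y0 \<in> feas_down A" for Y0
  proof -
    define Y where "Y s = Y0 s + (if s < b then 0 else A' s)" for s
    have "Y \<in> controls" unfolding Y_def
      using Y0 feas_down_subset c(2) controls_nonneg[OF c(2), of b]
      by (intro controls_add controls_splice zero_in_controls) blast+
    then have "Y \<in> feas_down A'"
    proof (rule feasible_down_transfer[OF c Y0])
      fix s :: real assume "0 \<le> s"
      have "A' r - Y s \<le> A r - Y0 s" if "r \<le> s" for r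
        using eq[of r] that controls_nonneg[OF c(1), of r] controls_mono[OF c(2) that] by (auto simp: Y_def)
      then show "(\<forall>r\<le>s. A' r - Y s \<le> A r - Y0 s) \<or> X (lead m) + \<omega> s + A' s - Y s \<le> q" by auto
    qed
    then have "B' t \<le> Y t" by (rule mutually_minimal_down_le[OF assms(2)])
    then show ?thesis using assms(4) by (simp add: Y_def)
  qed
  then show ?thesis by (rule mutually_minimal_down_greatest[OF assms(1)])
qed

text \<open>
  Since \<open>p < q\<close>, at the first time \<open>\<tau>\<close> of disagreement one of the
  two barriers is at a positive distance from the position. The corresponding control of the
  larger pair is flat around \<open>\<tau>\<close>, and it is squeezed against the smaller one,
  which is nondecreasing and agrees with it before \<open>\<tau>\<close>.
\<close>
lemma mutually_minimal_unique_above: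
  assumes s: "mutually_minimal A B" and s': "mutually_minimal A' B'" and le: "\<And>t. A t \<le> A' t" "\<And>t. B t \<le> B' t"
  shows "A' = A \<and> B' = B"
proof (rule ccontr)
  assume ne: "\<not> (A' = A \<and> B' = B)"
  define T where "T = {t. A' t \<noteq> A t \<or> B' t \<noteq> B t}"
  define \<tau> where "\<tau> = Inf T"
  have c: "A \<in> controls" "B \<in> controls" "A' \<in> controls" "B' \<in> controls"
    using mutually_minimal_controls[OF s] mutually_minimal_controls[OF s'] by auto
  have T: "T \<noteq> {}" using ne by (auto simp: T_def)
  have T0: "0 \<le> t" if "t \<in> T" for t
    using that c[THEN controls_zero] by (cases "t < 0") (auto simp: T_def)
  then have bdd: "bdd_below T" by (auto intro!: bdd_belowI)
  have \<tau>0: "0 \<le> \<tau>" unfolding \<tau>_def using T T0 by (intro cInf_greatest)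
  have before: "A' t = A t" "B' t = B t" if "t < \<tau>" for t
    using that cInf_lower[OF _ bdd] unfolding \<tau>_def T_def by (force simp: not_le)+
  have contra: False if "\<tau> < b" "\<And>t. t < b \<Longrightarrow> A' t = A t \<and> B' t = B t" for b
  proof -
    have "b \<le> \<tau>" unfolding \<tau>_def using T that by (intro cInf_greatest) (force simp: T_def not_less)+
    then show False using that by simp
  qed
  let ?I = "X (lead m) + \<omega> \<tau> + A' \<tau> - B' \<tau>"
  have \<omega>_near: "\<exists>d>0. \<forall>s\<ge>0. \<bar>s - \<tau>\<bar> < d \<longrightarrow> \<bar>\<omega> s - \<omega> \<tau>\<bar> < e" if "e > 0" for e
    using \<omega> \<tau>0 that unfolding continuous_on_iff dist_real_def by force
  consider "p < ?I" | "?I < q" using gap by linarith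
  then show False
  proof cases
    case 1
    \<comment> \<open>One third of the distance each for the path, for the other control and for the cap.\<close>
    define e where "e = (?I - p) / 3"
    have e: "0 < e" using 1 by (simp add: e_def)
    obtain d1 where d1: "d1 > 0" "\<And>s. s \<ge> 0 \<Longrightarrow> \<bar>s - \<tau>\<bar> < d1 \<Longrightarrow> \<bar>\<omega> s - \<omega> \<tau>\<bar> < e"
      using \<omega>_near[OF e] by blast
    obtain d2 where d2: "d2 > 0" "\<And>s. s < \<tau> + d2 \<Longrightarrow> B' s < B' \<tau> + e"
      using right_nbhd_small[OF c(4) e] by blast
    define r b where "r = \<tau> - d1 / 2" and "b = \<tau> + min d1 d2"
    have rb: "r < \<tau>" "\<tau> < b" using d1 d2 by (auto simp: r_def b_def)
    have "A' t \<le> max (max 0 (A' \<tau> - e)) (A' r)" if "r \<le> t" "t < b" for t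
    proof (rule upper_flat[OF s' _ _ that])
      fix u assume u: "0 \<le> u" "r \<le> u" "u < b"
      have "\<bar>\<omega> u - \<omega> \<tau>\<bar> < e" using u d1 by (intro d1(2)) (auto simp: r_def b_def)
      moreover have "B' u < B' \<tau> + e" using u by (intro d2(2)) (auto simp: b_def)
      moreover have "p = ?I - 3 * e" by (simp add: e_def field_simps)
      ultimately show "p \<le> X (lead m) + \<omega> u + max 0 (A' \<tau> - e) - B' u" by linarith
    qed simp
    from flat_near[OF c(3) e rb this]
    have "A' t = A' r" if "r \<le> t" "t < b" for t using that by blast
    then have eqA: "A' t = A t" if "t < b" for t
      using that before(1)[of t] before(1)[of r] rb le(1)[of t] controls_mono[OF c(1), of r t]
      by (cases "t < \<tau>") force+
    then have "B' t = B t" if "t < b" for t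
      using lower_causal[OF s s' _ that] le(2)[of t] by force
    then show False using contra[OF rb(2)] eqA by blast
  next
    case 2
    define e where "e = (q - ?I) / 3"
    have e: "0 < e" using 2 by (simp add: e_def)
    obtain d1 where d1: "d1 > 0" "\<And>s. s \<ge> 0 \<Longrightarrow> \<bar>s - \<tau>\<bar> < d1 \<Longrightarrow> \<bar>\<omega> s - \<omega> \<tau>\<bar> < e"
      using \<omega>_near[OF e] by blast
    obtain d2 where d2: "d2 > 0" "\<And>s. s < \<tau> + d2 \<Longrightarrow> A' s < A' \<tau> + e"
      using right_nbhd_small[OF c(3) e] by blast
    define r b where "r = \<tau> - d1 / 2" and "b = \<tau> + min d1 d2"
    have rb: "r < \<tau>" "\<tau> < b" using d1 d2 by (auto simp: r_def b_def)
    have "B' t \<le> max (max 0 (B' \<tau> - e)) (B' r)" if "r \<le> t" "t < b" for t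
    proof (rule lower_flat[OF s' _ _ that])
      fix u assume u: "0 \<le> u" "r \<le> u" "u < b"
      have "\<bar>\<omega> u - \<omega> \<tau>\<bar> < e" using u d1 by (intro d1(2)) (auto simp: r_def b_def)
      moreover have "A' u < A' \<tau> + e" using u by (intro d2(2)) (auto simp: b_def)
      moreover have "q = ?I + 3 * e" by (simp add: e_def field_simps)
      ultimately show "X (lead m) + \<omega> u + A' u - max 0 (B' \<tau> - e) \<le> q" by linarith
    qed simp
    from flat_near[OF c(4) e rb this]
    have "B' t = B' r" if "r \<le> t" "t < b" for t using that by blast
    then have eqB: "B' t = B t" if "t < b" for t
      using that before(2)[of t] before(2)[of r] rb le(2)[of t] controls_mono[OF c(2), of r t]
      by (cases "t < \<tau>") force+
    then have "A' t = A t" if "t < b" for t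
      using upper_causal[OF s s' _ that] le(1)[of t] by force
    then show False using contra[OF rb(2)] eqB by blast
  qed
qed

theorem ex1_two_sided_reflection: "\<exists>!Y. two_sided_reflection m X \<omega> Y"
proof -
  obtain A B where AB: "mutually_minimal A B" "\<And>A' B'. mutually_minimal A' B' \<Longrightarrow> (\<forall>t. A t \<le> A' t) \<and> (\<forall>t. B t \<le> B' t)"
    using ex_least_mutually_minimal by blast
  show ?thesis
  proof (rule ex1I[of _ "(A, B)"])
    show "two_sided_reflection m X \<omega> (A, B)" using AB two_sided_reflection_iff by blast
  next
    fix Y assume Y: "two_sided_reflection m X \<omega> Y"
    obtain A' B' where Y': "Y = (A', B')" by force
    then have "mutually_minimal A' B'" using Y two_sided_reflection_iff by blast
    then show "Y = (A, B)" using mutually_minimal_unique_above[OF AB(1)] AB(2) Y' by blast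
  qed
qed

end
end

section \<open>Measurability of adapted processes\<close>

lemma space_path_sigma [simp]: "space (path_sigma T) = paths"
  by (auto simp: path_sigma_def intro!: space_measure_of)

lemma coordinate_set_in_path_sigma:
  assumes "s \<in> T" "B \<in> sets borel"
  shows "{\<omega> \<in> paths. \<omega> s \<in> B} \<in> sets (path_sigma T)"
  unfolding path_sigma_def using assms by (subst sets_measure_of) (auto intro!: sigma_sets.Basic)

lemma sets_path_sigma_mono: "S \<subseteq> T \<Longrightarrow> sets (path_sigma S) \<subseteq> sets (path_sigma T)"
  unfolding path_sigma_def by (subst (1 2) sets_measure_of) (auto intro!: sigma_sets_mono')

text \<open>
  A right-continuous process is the limit of its discretisations, each of which is sampled at
  countably many times; the times \<open>q n t\<close> decrease to \<open>t\<close> from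
  strictly above it.
\<close>
lemma borel_measurable_pair_right_continuous:
  fixes Z :: "'a \<Rightarrow> real \<Rightarrow> real"
  assumes meas: "\<And>t. (\<lambda>x. Z x t) \<in> borel_measurable M"
    and rc: "\<And>x t. x \<in> space M \<Longrightarrow> continuous (at_right t) (Z x)"
  shows "(\<lambda>(x, t). Z x t) \<in> borel_measurable (M \<Otimes>\<^sub>M lborel)"
proof -
  define q :: "nat \<Rightarrow> real \<Rightarrow> real" where "q n t = (of_int \<lfloor>(real n + 1) * t\<rfloor> + 1) / (real n + 1)" for n t
  have q_gt: "t < q n t" and q_le: "q n t \<le> t + 1 / (real n + 1)" for n t
  proof -
    have "(real n + 1) * t < of_int \<lfloor>(real n + 1) * t\<rfloor> + 1" by linarith
    then show "t < q n t" by (simp add: q_def field_simps)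
    have "of_int \<lfloor>(real n + 1) * t\<rfloor> + 1 \<le> (real n + 1) * t + 1" by linarith
    then have "q n t \<le> ((real n + 1) * t + 1) / (real n + 1)"
      unfolding q_def by (intro divide_right_mono) auto
    also have "\<dots> = t + 1 / (real n + 1)" by (simp add: field_simps)
    finally show "q n t \<le> t + 1 / (real n + 1)" .
  qed
  have q_lim: "filterlim (\<lambda>n. q n t) (at_right t) sequentially" for t
  proof (rule tendsto_imp_filterlim_at_right)
    have "(\<lambda>n. t + 1 / (real n + 1)) \<longlonglongrightarrow> t + 0"
      using LIMSEQ_inverse_real_of_nat by (intro tendsto_add tendsto_const) (simp add: field_simps)
    then have "(\<lambda>n. t + 1 / (real n + 1)) \<longlonglongrightarrow> t" by simp
    then show "(\<lambda>n. q n t) \<longlonglongrightarrow> t"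
      by (rule tendsto_sandwich[OF always_eventually always_eventually tendsto_const, rotated 2])
        (use q_gt q_le less_imp_le in blast)+
    show "\<forall>\<^sub>F n in sequentially. t < q n t" by (intro always_eventually allI q_gt)
  qed
  have "(\<lambda>p. Z (fst p) (snd p)) \<in> borel_measurable (M \<Otimes>\<^sub>M lborel)"
  proof (rule borel_measurable_LIMSEQ_real)
    fix p :: "'a \<times> real" assume "p \<in> space (M \<Otimes>\<^sub>M lborel)"
    then have "fst p \<in> space M" by (auto simp: space_pair_measure)
    then have "(Z (fst p) \<longlongrightarrow> Z (fst p) (snd p)) (at_right (snd p))"
      using rc unfolding continuous_within by blast
    then show "(\<lambda>n. Z (fst p) (q n (snd p))) \<longlonglongrightarrow> Z (fst p) (snd p)"
      by (rule filterlim_compose[OF _ q_lim])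
  next
    fix n
    have "(\<lambda>p. (\<lambda>i p. Z (fst p) ((of_int i + 1) / (real n + 1))) \<lfloor>(real n + 1) * snd p\<rfloor> p)
        \<in> borel_measurable (M \<Otimes>\<^sub>M lborel)"
    proof (rule measurable_compose_countable[where f="\<lambda>i p. Z (fst p) ((of_int i + 1) / (real n + 1))"
          and g="\<lambda>p. \<lfloor>(real n + 1) * snd p\<rfloor>"])
      show "(\<lambda>p. Z (fst p) ((of_int i + 1) / (real n + 1))) \<in> borel_measurable (M \<Otimes>\<^sub>M lborel)" for i :: int
        by (rule measurable_compose[OF measurable_fst meas])
      show "(\<lambda>p. \<lfloor>(real n + 1) * snd p\<rfloor>) \<in> measurable (M \<Otimes>\<^sub>M lborel) (count_space UNIV)"
        by measurable
    qed
    then show "(\<lambda>p. Z (fst p) (q n (snd p))) \<in> borel_measurable (M \<Otimes>\<^sub>M lborel)"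
      by (simp add: q_def)
  qed
  then show ?thesis by (simp add: case_prod_beta')
qed

section \<open>Auxiliary facts on integrals, infima and convex functions\<close>

lemma nn_integral_exp_tail:
  assumes "0 < g"
  shows "(\<integral>\<^sup>+t\<in>{a..}. ennreal (g * exp (- g * t)) \<partial>lborel) = ennreal (exp (- g * a))"
proof -
  have lim: "((\<lambda>t. - exp (- g * t)) \<longlongrightarrow> - 0) at_top"
    by (intro tendsto_minus filterlim_compose[OF exp_at_bot] filterlim_tendsto_neg_mult_at_bot[OF tendsto_const]
        filterlim_ident) (use assms in auto)
  have "(\<integral>\<^sup>+t. ennreal (g * exp (- g * t)) * indicator {a..} t \<partial>lborel) = ennreal (0 - - exp (- g * a))"
    using lim assms
    by (intro nn_integral_FTC_atLeast) (auto intro!: derivative_eq_intros)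
  then show ?thesis by simp
qed

text \<open>
  Integration by parts, as Tonelli's theorem for the representation of the discount factor
  \<open>exp (- disc m * s)\<close> as the integral of its negative derivative over
  \<open>{s..}\<close>. It makes the adjustment cost linear in the control itself, which is what
  the lattice inequality needs.
\<close>
lemma discounted_eq_nn_integral:
  assumes Y: "Y \<in> controls" and "0 < disc m"
  shows "discounted m Y = (\<integral>\<^sup>+t\<in>{0..}. ennreal (disc m * exp (- disc m * t) * Y t) \<partial>lborel)"
proof -
  let ?g = "\<lambda>t. ennreal (disc m * exp (- disc m * t))"
  interpret S: sigma_finite_measure "interval_measure Y"
    using controls_mono[OF Y] controls_right_continuous[OF Y] by (rule sigma_finite_interval_measure)
  interpret pair_sigma_finite lborel "interval_measure Y" ..
  have lim: "(Y \<longlongrightarrow> 0) at_bot"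
  proof (rule tendsto_eventually)
    show "\<forall>\<^sub>F t in at_bot. Y t = 0"
      using eventually_gt_at_bot[of "0::real"] by eventually_elim (rule controls_zero[OF Y])
  qed
  have "discounted m Y = (\<integral>\<^sup>+s. (\<integral>\<^sup>+t. ?g t * indicator {s..} t \<partial>lborel) \<partial>interval_measure Y)"
    unfolding discounted_def using nn_integral_exp_tail[OF assms(2)] by simp
  also have "\<dots> = (\<integral>\<^sup>+t. (\<integral>\<^sup>+s. ?g t * indicator {s..} t \<partial>interval_measure Y) \<partial>lborel)"
  proof (rule Fubini')
    have "(\<lambda>(t, s). ?g t * (if s \<le> t then 1 else 0)) \<in> borel_measurable (lborel \<Otimes>\<^sub>M interval_measure Y)"
      by measurable
    then show "(\<lambda>(t, s). ?g t * indicator {s..} t) \<in> borel_measurable (lborel \<Otimes>\<^sub>M interval_measure Y)"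
      by (simp add: indicator_def of_bool_def)
  qed
  also have "\<dots> = (\<integral>\<^sup>+t\<in>{0..}. ennreal (disc m * exp (- disc m * t) * Y t) \<partial>lborel)"
  proof (rule nn_integral_cong)
    fix t
    have "(\<integral>\<^sup>+s. ?g t * indicator {s..} t \<partial>interval_measure Y) = (\<integral>\<^sup>+s. ?g t * indicator {..t} s \<partial>interval_measure Y)"
      by (intro nn_integral_cong) (simp add: indicator_def)
    also have "\<dots> = ?g t * emeasure (interval_measure Y) {..t}"
      by (rule nn_integral_cmult_indicator) simp
    also have "emeasure (interval_measure Y) {..t} = ennreal (Y t)"
      by (rule emeasure_interval_measure_Iic[OF controls_mono[OF Y] controls_right_continuous[OF Y] lim])
    also have "?g t * ennreal (Y t) = ennreal (disc m * exp (- disc m * t) * Y t)"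
      using assms(2) controls_nonneg[OF Y] by (intro ennreal_mult[symmetric]) auto
    also have "\<dots> = ennreal (disc m * exp (- disc m * t) * Y t) * indicator {0..} t"
      using controls_zero[OF Y, of t] by (auto simp: indicator_def)
    finally show "(\<integral>\<^sup>+s. ?g t * indicator {s..} t \<partial>interval_measure Y)
      = ennreal (disc m * exp (- disc m * t) * Y t) * indicator {0..} t" .
  qed
  finally show ?thesis .
qed

lemma convex_on_sum_between:
  fixes f :: "real \<Rightarrow> real"
  assumes f: "convex_on UNIV f" and "a + b = c + d" "min c d \<le> a" "a \<le> max c d"
  shows "f a + f b \<le> f c + f d"
proof -
  have *: "f a + f b \<le> f c + f d" if "c < d" "c \<le> a" "a \<le> d" "a + b = c + d" for c d
  proof -
    define u where "u = (a - c) / (d - c)"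
    have u: "0 \<le> u" "u \<le> 1" using that by (auto simp: u_def)
    have ud: "u * (d - c) = a - c" using that by (simp add: u_def)
    have a: "a = (1 - u) *\<^sub>R c + u *\<^sub>R d" using ud by (simp add: algebra_simps)
    have b: "b = (1 - u) *\<^sub>R d + u *\<^sub>R c" using ud that(4) by (simp add: algebra_simps)
    have "f a \<le> (1 - u) * f c + u * f d" unfolding a using u f by (intro convex_onD) auto
    moreover have "f b \<le> (1 - u) * f d + u * f c" unfolding b using u f by (intro convex_onD) auto
    ultimately show ?thesis by (simp add: algebra_simps)
  qed
  consider "c < d" | "d < c" | "c = d" by linarith
  then show ?thesis
  proof cases
    case 1
    then show ?thesis using *[of c d] assms by auto
  next
    case 2
    then show ?thesis using *[of d c] assms by auto
  next
    case 3
    then have "a = c" "b = d" using assms by auto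
    then show ?thesis by simp
  qed
qed

lemma ennreal_INF_approx:
  fixes f :: "'i \<Rightarrow> ennreal"
  assumes "(INF i\<in>I. f i) < top" "0 < e"
  shows "\<exists>i\<in>I. f i \<le> (INF i\<in>I. f i) + ennreal e"
proof -
  have "(INF i\<in>I. f i) + 0 < (INF i\<in>I. f i) + ennreal e"
    unfolding ennreal_add_left_cancel_less infinity_ennreal_def using assms by (metis ennreal_less_zero_iff less_irrefl)
  then have "(INF i\<in>I. f i) < (INF i\<in>I. f i) + ennreal e" by (simp only: add_0_right)
  then show ?thesis unfolding INF_less_iff by (auto intro: less_imp_le)
qed

lemma le_INF_add_INF_ennreal:
  fixes f :: "'i \<Rightarrow> ennreal" and g :: "'j \<Rightarrow> ennreal"
  assumes "\<And>i j. i \<in> I \<Longrightarrow> j \<in> inf_cost \<Longrightarrow> c \<le> f i + g j"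
  shows "c \<le> (INF i\<in>I. f i) + (INF j\<in>inf_cost. g j)"
proof (rule ennreal_le_epsilon)
  fix e :: real assume fin: "(INF i\<in>I. f i) + (INF j\<in>inf_cost. g j) < top" and "0 < e"
  obtain i where i: "i \<in> I" "f i \<le> (INF i\<in>I. f i) + ennreal (e / 2)"
    using ennreal_INF_approx[of f I "e / 2"] fin \<open>0 < e\<close> by auto
  obtain j where j: "j \<in> inf_cost" "g j \<le> (INF j\<in>inf_cost. g j) + ennreal (e / 2)"
    using ennreal_INF_approx[of g inf_cost "e / 2"] fin \<open>0 < e\<close> by auto
  have "c \<le> f i + g j" by (rule assms[OF i(1) j(1)])
  also have "\<dots> \<le> ((INF i\<in>I. f i) + ennreal (e / 2)) + ((INF j\<in>inf_cost. g j) + ennreal (e / 2))"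
    by (intro add_mono i j)
  also have "\<dots> = (INF i\<in>I. f i) + (INF j\<in>inf_cost. g j) + (ennreal (e / 2) + ennreal (e / 2))"
    by (simp add: ac_simps)
  also have "ennreal (e / 2) + ennreal (e / 2) = ennreal e"
    using \<open>0 < e\<close> by (subst ennreal_plus[symmetric]) auto
  finally show "c \<le> (INF i\<in>I. f i) + (INF j\<in>inf_cost. g j) + ennreal e" .
qed

text \<open>
  The derivative bound at all but finitely many points integrates to a Lipschitz bound.
\<close>
lemma piecewise_C2_lipschitz:
  assumes h: "piecewise_C2 h" and b: "\<And>x d. (h has_real_derivative d) (at x) \<Longrightarrow> \<bar>d\<bar> \<le> M"
  shows "\<bar>h y - h x\<bar> \<le> M * \<bar>y - x\<bar>"
proof -
  obtain S h' where S: "finite S" and d: "\<And>x. x \<in> - S \<Longrightarrow> (h has_real_derivative h' x) (at x)"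
    and c: "continuous_on UNIV h"
    using h unfolding piecewise_C2_def by blast
  have *: "\<bar>h y - h x\<bar> \<le> M * (y - x)" if "x \<le> y" for x y
  proof -
    define g where "g t = (if t \<in> S then 0 else h' t)" for t
    obtain z where "z \<notin> S" using S ex_new_if_finite[OF infinite_UNIV_char_0] by blast
    then have M0: "0 \<le> M" using b[OF d, of z] by auto
    have "(g has_integral (h y - h x)) {x..y}"
      using S that
    proof (rule fundamental_theorem_of_calculus_interior_strong)
      fix t assume "t \<in> {x<..<y} - S"
      then show "(h has_vector_derivative g t) (at t)"
        using d[of t] by (simp add: g_def has_real_derivative_iff_has_vector_derivative)
    qed (rule continuous_on_subset[OF c], simp)
    then have "norm (h y - h x) \<le> M * measure lborel {x..y}"
    proof (rule has_integral_bound_real[OF M0 finite.emptyI])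
      fix t assume "t \<in> {x..y} - {}"
      show "norm (g t) \<le> M" using M0 b[OF d, of t] by (auto simp: g_def)
    qed
    then show ?thesis using that by simp
  qed
  show ?thesis using *[of x y] *[of y x] by (cases "x \<le> y") (auto simp: abs_minus_commute)
qed

lemma states_add_const:
  assumes "X \<in> states m"
  shows "(\<lambda>u. X u + c) \<in> states m"
proof (rule statesI)
  show "mono_on {0..} (\<lambda>u. X u + c)"
    by (rule mono_onI) (simp add: states_mono[OF assms])
  show "continuous (at_right t) (\<lambda>u. X u + c)" if "0 \<le> t" for t
    by (intro continuous_add continuous_const states_right_continuous[OF assms that])
  show "X u + c = X (lead m) + c" if "lead m \<le> u" for u
    by (simp add: states_const[OF assms that])
qed

lemma const_in_states: "(\<lambda>_. c) \<in> states m"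
  by (rule statesI) (auto intro!: mono_onI)

lemma adjust_in_states:
  assumes "X \<in> states m" "0 \<le> a" "0 < lead m"
  shows "adjust m a b X \<in> states m"
proof -
  have "(\<lambda>u. X u + a * indicator {lead m..} u) \<in> states m"
  proof (rule statesI)
    show "mono_on {0..} (\<lambda>u. X u + a * indicator {lead m..} u)"
    proof (rule mono_onI)
      fix u v :: real assume "u \<in> {0..}" "v \<in> {0..}" "u \<le> v"
      then show "X u + a * indicator {lead m..} u \<le> X v + a * indicator {lead m..} v"
        using assms(2) states_mono[OF assms(1), of u v] by (auto simp: indicator_def)
    qed
    fix t :: real assume t: "0 \<le> t"
    have "\<forall>\<^sub>F s in at_right t. indicator {lead m..} t = (indicator {lead m..} s :: real)"
    proof (cases "t < lead m")
      case True
      then show ?thesis unfolding eventually_at_right_field by (intro exI[of _ "lead m"]) auto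
    next
      case False
      then show ?thesis unfolding eventually_at_right_field by (intro exI[of _ "t + 1"]) auto
    qed
    then have "continuous (at_right t) (indicator {lead m..} :: real \<Rightarrow> real)"
      unfolding continuous_within by (rule Lim_transform_eventually[OF tendsto_const])
    then show "continuous (at_right t) (\<lambda>u. X u + a * indicator {lead m..} u)"
      by (intro continuous_add continuous_mult continuous_const states_right_continuous[OF assms(1) t])
  next
    show "X u + a * indicator {lead m..} u = X (lead m) + a * indicator {lead m..} (lead m)"
      if "lead m \<le> u" for u
      using states_const[OF assms(1) that] that by simp
  qed
  from states_add_const[OF this, of "- b"] show ?thesis by (simp add: adjust_def algebra_simps)
qed

section \<open>The cost of a policy as an iterated integral\<close>

locale admissible =
  fixes m :: inventory_model
  assumes adm: "admissible_model m"
begin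

abbreviation "\<gamma> \<equiv> disc m"
abbreviation "h \<equiv> hold m"

lemma params: "0 < lead m" "0 < \<gamma>" "0 < k_up m" "0 < k_down m" "0 \<le> h x"
  and h_convex: "convex_on UNIV h"
  and h_lipschitz: "\<bar>h y - h x\<bar> \<le> slope_bound m * \<bar>y - x\<bar>"
  and slope_pos: "0 < slope_bound m"
  using adm piecewise_C2_lipschitz[of h "slope_bound m" y x] unfolding admissible_model_def by auto

lemma h_measurable [measurable]: "h \<in> borel_measurable borel"
  using adm unfolding admissible_model_def piecewise_C2_def by (auto intro: borel_measurable_continuous_onI)

sublocale law: prob_space "law m"
  using adm unfolding admissible_model_def brownian_law_def by auto

lemma space_law [simp]: "space (law m) = paths"
  and sets_law: "sets (law m) = sets (path_sigma {0..})"
  using adm unfolding admissible_model_def brownian_law_def by auto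

lemma coordinate_measurable: "(\<lambda>\<omega>. \<omega> (max 0 t)) \<in> borel_measurable (law m)"
proof (rule measurableI)
  fix B :: "real set" assume "B \<in> sets borel"
  then have "{\<omega> \<in> paths. \<omega> (max 0 t) \<in> B} \<in> sets (law m)"
    unfolding sets_law by (intro coordinate_set_in_path_sigma) auto
  moreover have "(\<lambda>\<omega>. \<omega> (max 0 t)) -` B \<inter> space (law m) = {\<omega> \<in> paths. \<omega> (max 0 t) \<in> B}" by auto
  ultimately show "(\<lambda>\<omega>. \<omega> (max 0 t)) -` B \<inter> space (law m) \<in> sets (law m)" by simp
qed simp

lemma adapted_in_controls: "adapted_control Y \<Longrightarrow> \<omega> \<in> paths \<Longrightarrow> Y \<omega> \<in> controls"
  by (simp add: adapted_control_def)

lemma adapted_measurable: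
  assumes "adapted_control Y"
  shows "(\<lambda>\<omega>. Y \<omega> t) \<in> borel_measurable (law m)"
proof (cases "t < 0")
  case True
  then have "Y \<omega> t = 0" if "\<omega> \<in> space (law m)" for \<omega>
    using controls_zero[OF adapted_in_controls[OF assms]] that by simp
  then show ?thesis by (subst measurable_cong[where g="\<lambda>_. 0"]) auto
next
  case False
  then have Y: "(\<lambda>\<omega>. Y \<omega> t) \<in> borel_measurable (natural_filtration t)"
    using assms by (simp add: adapted_control_def)
  have "sets (natural_filtration t) \<subseteq> sets (law m)" unfolding sets_law by (rule sets_path_sigma_mono) auto
  then show ?thesis using measurable_mono[of borel borel "natural_filtration t" "law m"] Y by auto
qed

lemma adapted_pair_measurable:
  assumes "adapted_control Y"
  shows "(\<lambda>(\<omega>, t). Y \<omega> t) \<in> borel_measurable (law m \<Otimes>\<^sub>M lborel)"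
proof (rule borel_measurable_pair_right_continuous[OF adapted_measurable[OF assms]])
  fix \<omega> t assume "\<omega> \<in> space (law m)"
  then show "continuous (at_right t) (Y \<omega>)"
    by (intro controls_right_continuous adapted_in_controls[OF assms]) simp
qed

lemma path_pair_measurable: "(\<lambda>(\<omega>, t). \<omega> (max 0 t)) \<in> borel_measurable (law m \<Otimes>\<^sub>M lborel)"
proof (rule borel_measurable_pair_right_continuous[OF coordinate_measurable])
  fix \<omega> :: "real \<Rightarrow> real" and t assume "\<omega> \<in> space (law m)"
  then have "continuous_on {0..} \<omega>" by (simp add: paths_def)
  then have "continuous_on UNIV (\<lambda>t. \<omega> (max 0 t))"
    by (rule continuous_on_compose2) (auto intro!: continuous_intros)
  then show "continuous (at_right t) (\<lambda>t. \<omega> (max 0 t))"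
    by (simp add: continuous_on_eq_continuous_at continuous_at_imp_continuous_within)
qed

lemma state_measurable:
  assumes "X \<in> states m"
  shows "(\<lambda>t. X (max 0 t)) \<in> borel_measurable borel"
proof (rule borel_measurable_mono)
  show "mono (\<lambda>t. X (max 0 t))"
    by (rule monoI, rule states_mono[OF assms]) auto
qed

text \<open>
  The inventory on hand, which is the state at time \<open>t\<close> evaluated at
  \<open>0\<close>. The initial state and the path are extended constantly to negative times,
  where they are unspecified, so that the result is measurable jointly in the path and the time.
\<close>
definition net_inventory :: "(real \<Rightarrow> real) \<Rightarrow> (real \<Rightarrow> real) \<Rightarrow> (real \<Rightarrow> real) \<Rightarrow> (real \<Rightarrow> real) \<Rightarrow> real \<Rightarrow> real" where
  "net_inventory X \<omega> A B t = X (max 0 t) + \<omega> (max 0 t) + A (t - lead m) - B t"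

text \<open>
  The discounted cost density after integration by parts: the term
  \<open>disc m * k * Y t\<close> replaces the proportional cost \<open>k\<close> of the
  increments of \<open>Y\<close>.
\<close>
definition cost_rate :: "(real \<Rightarrow> real) \<Rightarrow> (real \<Rightarrow> real) \<Rightarrow> (real \<Rightarrow> real) \<Rightarrow> (real \<Rightarrow> real) \<Rightarrow> real \<Rightarrow> real" where
  "cost_rate X \<omega> A B t = exp (- \<gamma> * t) * (h (net_inventory X \<omega> A B t) + \<gamma> * (k_up m * A t + k_down m * B t))"

definition path_cost :: "(real \<Rightarrow> real) \<Rightarrow> (real \<Rightarrow> real) \<Rightarrow> (real \<Rightarrow> real) \<Rightarrow> (real \<Rightarrow> real) \<Rightarrow> ennreal" where
  "path_cost X \<omega> A B = (\<integral>\<^sup>+t\<in>{0..}. ennreal (cost_rate X \<omega> A B t) \<partial>lborel)"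

lemma net_inventory_measurable:
  assumes X: "X \<in> states m" and A: "adapted_control A" and B: "adapted_control B"
  shows "(\<lambda>(\<omega>, t). net_inventory X \<omega> (A \<omega>) (B \<omega>) t) \<in> borel_measurable (law m \<Otimes>\<^sub>M lborel)"
proof -
  note [measurable] = state_measurable[OF X]
  have [measurable]: "(\<lambda>p. A (fst p) (snd p)) \<in> borel_measurable (law m \<Otimes>\<^sub>M lborel)"
    "(\<lambda>p. B (fst p) (snd p)) \<in> borel_measurable (law m \<Otimes>\<^sub>M lborel)"
    "(\<lambda>p. (fst p) (max 0 (snd p))) \<in> borel_measurable (law m \<Otimes>\<^sub>M lborel)"
    using adapted_pair_measurable[OF A] adapted_pair_measurable[OF B] path_pair_measurable
    by (simp_all add: case_prod_beta')
  have "(\<lambda>p. (fst p, snd p - lead m)) \<in> measurable (law m \<Otimes>\<^sub>M lborel) (law m \<Otimes>\<^sub>M lborel)" by measurable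
  from measurable_compose[OF this, of "\<lambda>p. A (fst p) (snd p)" borel]
  have [measurable]: "(\<lambda>p. A (fst p) (snd p - lead m)) \<in> borel_measurable (law m \<Otimes>\<^sub>M lborel)" by simp
  have "(\<lambda>p. X (max 0 (snd p))) \<in> borel_measurable (law m \<Otimes>\<^sub>M lborel)"
    by (rule measurable_compose[OF _ state_measurable[OF X]]) measurable
  then show ?thesis unfolding net_inventory_def case_prod_beta' by measurable
qed

lemma cost_rate_measurable:
  assumes X: "X \<in> states m" and A: "adapted_control A" and B: "adapted_control B"
  shows "(\<lambda>(\<omega>, t). cost_rate X \<omega> (A \<omega>) (B \<omega>) t) \<in> borel_measurable (law m \<Otimes>\<^sub>M lborel)"
proof -
  have [measurable]: "(\<lambda>p. A (fst p) (snd p)) \<in> borel_measurable (law m \<Otimes>\<^sub>M lborel)"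
    "(\<lambda>p. B (fst p) (snd p)) \<in> borel_measurable (law m \<Otimes>\<^sub>M lborel)"
    "(\<lambda>p. net_inventory X (fst p) (A (fst p)) (B (fst p)) (snd p)) \<in> borel_measurable (law m \<Otimes>\<^sub>M lborel)"
    using adapted_pair_measurable[OF A] adapted_pair_measurable[OF B] net_inventory_measurable[OF assms]
    by (simp_all add: case_prod_beta')
  show ?thesis unfolding cost_rate_def case_prod_beta' by measurable
qed

lemma path_section_measurable:
  assumes "(\<lambda>(\<omega>, t). Z \<omega> t) \<in> borel_measurable (law m \<Otimes>\<^sub>M lborel)" "\<omega> \<in> paths"
  shows "Z \<omega> \<in> borel_measurable borel"
  using measurable_Pair2[OF assms(1), of \<omega>] assms(2) by simp

lemma path_cost_measurable:
  assumes X: "X \<in> states m" and A: "adapted_control A" and B: "adapted_control B"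
  shows "(\<lambda>\<omega>. path_cost X \<omega> (A \<omega>) (B \<omega>)) \<in> borel_measurable (law m)"
  unfolding path_cost_def
proof (rule lborel.borel_measurable_nn_integral)
  have [measurable]: "(\<lambda>p. cost_rate X (fst p) (A (fst p)) (B (fst p)) (snd p)) \<in> borel_measurable (law m \<Otimes>\<^sub>M lborel)"
    using cost_rate_measurable[OF assms] by (simp add: case_prod_beta')
  show "(\<lambda>(\<omega>, t). ennreal (cost_rate X \<omega> (A \<omega>) (B \<omega>) t) * indicator {0..} t) \<in> borel_measurable (law m \<Otimes>\<^sub>M lborel)"
    unfolding case_prod_beta' by measurable
qed

lemma cost_rate_nonneg: "A \<in> controls \<Longrightarrow> B \<in> controls \<Longrightarrow> 0 \<le> cost_rate X \<omega> A B t"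
  unfolding cost_rate_def using params controls_nonneg[of A t] controls_nonneg[of B t]
  by (intro mult_nonneg_nonneg add_nonneg_nonneg) auto

lemma control_measurable:
  assumes "Y \<in> controls"
  shows "Y \<in> borel_measurable borel"
  by (rule borel_measurable_mono, rule monoI) (rule controls_mono[OF assms])

lemma policy_cost_eq:
  assumes X: "X \<in> states m" and A: "adapted_control A" and B: "adapted_control B"
  shows "policy_cost m X (A, B) = (\<integral>\<^sup>+\<omega>. path_cost X \<omega> (A \<omega>) (B \<omega>) \<partial>law m)"
  unfolding policy_cost_def prod.case
proof (rule nn_integral_cong)
  fix \<omega> assume "\<omega> \<in> space (law m)"
  then have \<omega>: "\<omega> \<in> paths" by simp
  have cA: "A \<omega> \<in> controls" and cB: "B \<omega> \<in> controls" using adapted_in_controls \<omega> A B by auto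
  note [measurable] = control_measurable[OF cA] control_measurable[OF cB]
    path_section_measurable[OF net_inventory_measurable[OF assms] \<omega>]
  have net_inventory: "state_at m X \<omega> (A \<omega>) (B \<omega>) t 0 = net_inventory X \<omega> (A \<omega>) (B \<omega>) t" if "0 \<le> t" for t
    using that params(1) by (simp add: state_at_def net_inventory_def max_def)
  have "(\<integral>\<^sup>+t\<in>{0..}. ennreal (exp (- \<gamma> * t) * h (state_at m X \<omega> (A \<omega>) (B \<omega>) t 0)) \<partial>lborel)
     = (\<integral>\<^sup>+t\<in>{0..}. ennreal (exp (- \<gamma> * t) * h (net_inventory X \<omega> (A \<omega>) (B \<omega>) t)) \<partial>lborel)"
    using net_inventory by (intro nn_integral_cong) (auto simp: indicator_def)
  moreover have "ennreal (k_up m) * discounted m (A \<omega>)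
      = (\<integral>\<^sup>+t\<in>{0..}. ennreal (k_up m * (\<gamma> * exp (- \<gamma> * t) * A \<omega> t)) \<partial>lborel)"
    unfolding discounted_eq_nn_integral[OF cA params(2)] using params(3)
    by (subst nn_integral_cmult[symmetric]) (auto simp: ennreal_mult' mult.assoc intro!: nn_integral_cong)
  moreover have "ennreal (k_down m) * discounted m (B \<omega>)
      = (\<integral>\<^sup>+t\<in>{0..}. ennreal (k_down m * (\<gamma> * exp (- \<gamma> * t) * B \<omega> t)) \<partial>lborel)"
    unfolding discounted_eq_nn_integral[OF cB params(2)] using params(4)
    by (subst nn_integral_cmult[symmetric]) (auto simp: ennreal_mult' mult.assoc intro!: nn_integral_cong)
  moreover have "path_cost X \<omega> (A \<omega>) (B \<omega>)
      = (\<integral>\<^sup>+t. (ennreal (exp (- \<gamma> * t) * h (net_inventory X \<omega> (A \<omega>) (B \<omega>) t)) * indicator {0..} t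
          + (ennreal (k_up m * (\<gamma> * exp (- \<gamma> * t) * A \<omega> t)) * indicator {0..} t
          + ennreal (k_down m * (\<gamma> * exp (- \<gamma> * t) * B \<omega> t)) * indicator {0..} t)) \<partial>lborel)"
    unfolding path_cost_def
  proof (rule nn_integral_cong)
    fix t :: real
    have nn: "0 \<le> exp (- \<gamma> * t) * h (net_inventory X \<omega> (A \<omega>) (B \<omega>) t)" "0 \<le> k_up m * (\<gamma> * exp (- \<gamma> * t) * A \<omega> t)"
      "0 \<le> k_down m * (\<gamma> * exp (- \<gamma> * t) * B \<omega> t)"
      using params controls_nonneg[OF cA, of t] controls_nonneg[OF cB, of t]
      by (auto intro!: mult_nonneg_nonneg)
    have "cost_rate X \<omega> (A \<omega>) (B \<omega>) t = exp (- \<gamma> * t) * h (net_inventory X \<omega> (A \<omega>) (B \<omega>) t)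
      + (k_up m * (\<gamma> * exp (- \<gamma> * t) * A \<omega> t) + k_down m * (\<gamma> * exp (- \<gamma> * t) * B \<omega> t))"
      by (simp add: cost_rate_def algebra_simps)
    then have "ennreal (cost_rate X \<omega> (A \<omega>) (B \<omega>) t) = ennreal (exp (- \<gamma> * t) * h (net_inventory X \<omega> (A \<omega>) (B \<omega>) t))
      + (ennreal (k_up m * (\<gamma> * exp (- \<gamma> * t) * A \<omega> t)) + ennreal (k_down m * (\<gamma> * exp (- \<gamma> * t) * B \<omega> t)))"
      using nn by (simp add: ennreal_plus del: exp_minus)
    then show "ennreal (cost_rate X \<omega> (A \<omega>) (B \<omega>) t) * indicator {0..} t = ennreal (exp (- \<gamma> * t) * h (net_inventory X \<omega> (A \<omega>) (B \<omega>) t)) * indicator {0..} t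
          + (ennreal (k_up m * (\<gamma> * exp (- \<gamma> * t) * A \<omega> t)) * indicator {0..} t
          + ennreal (k_down m * (\<gamma> * exp (- \<gamma> * t) * B \<omega> t)) * indicator {0..} t)"
      by (simp add: distrib_right)
  qed
  ultimately show "(\<integral>\<^sup>+t\<in>{0..}. ennreal (exp (- \<gamma> * t) * h (state_at m X \<omega> (A \<omega>) (B \<omega>) t 0)) \<partial>lborel)
      + (ennreal (k_up m) * discounted m (A \<omega>) + ennreal (k_down m) * discounted m (B \<omega>))
      = path_cost X \<omega> (A \<omega>) (B \<omega>)"
    by (simp add: nn_integral_add)
qed

end

section \<open>Joins and meets of policies\<close>

lemma controls_combine:
  fixes f :: "real \<Rightarrow> real \<Rightarrow> real"
  assumes Y: "Y \<in> controls" and Z: "Z \<in> controls" and "f 0 0 = 0"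
    and mono: "\<And>y y' z z'. y \<le> y' \<Longrightarrow> z \<le> z' \<Longrightarrow> f y z \<le> f y' z'"
    and cont: "continuous_on UNIV (\<lambda>p. f (fst p) (snd p))"
  shows "(\<lambda>t. f (Y t) (Z t)) \<in> controls"
proof (rule controlsI)
  show "f (Y t) (Z t) = 0" if "t < 0" for t
    using controls_zero[OF Y that] controls_zero[OF Z that] assms(3) by simp
  show "f (Y s) (Z s) \<le> f (Y t) (Z t)" if "s \<le> t" for s t
    by (rule mono[OF controls_mono[OF Y that] controls_mono[OF Z that]])
  show "continuous (at_right t) (\<lambda>t. f (Y t) (Z t))" for t
  proof -
    have "((\<lambda>s. (Y s, Z s)) \<longlongrightarrow> (Y t, Z t)) (at_right t)"
      using controls_right_continuous[OF Y, of t] controls_right_continuous[OF Z, of t]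
      unfolding continuous_within by (rule tendsto_Pair)
    then have "((\<lambda>s. f (fst (Y s, Z s)) (snd (Y s, Z s))) \<longlongrightarrow> f (fst (Y t, Z t)) (snd (Y t, Z t))) (at_right t)"
      by (rule continuous_on_tendsto_compose[OF cont]) auto
    then show ?thesis by (simp add: continuous_within)
  qed
qed

lemma adapted_combine:
  fixes f :: "real \<Rightarrow> real \<Rightarrow> real"
  assumes Y: "adapted_control Y" and Z: "adapted_control Z" and f0: "f 0 0 = 0"
    and mono: "\<And>y y' z z'. y \<le> y' \<Longrightarrow> z \<le> z' \<Longrightarrow> f y z \<le> f y' z'"
    and cont: "continuous_on UNIV (\<lambda>p. f (fst p) (snd p))"
  shows "adapted_control (\<lambda>\<omega> t. f (Y \<omega> t) (Z \<omega> t))"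
  unfolding adapted_control_def
proof (intro conjI ballI allI impI)
  fix \<omega> assume "\<omega> \<in> paths"
  then have "Y \<omega> \<in> controls" "Z \<omega> \<in> controls" using Y Z by (simp_all add: adapted_control_def)
  then show "(\<lambda>t. f (Y \<omega> t) (Z \<omega> t)) \<in> controls" using f0 mono cont by (rule controls_combine)
next
  fix t :: real assume "0 \<le> t"
  then have "(\<lambda>\<omega>. Y \<omega> t) \<in> borel_measurable (natural_filtration t)"
    "(\<lambda>\<omega>. Z \<omega> t) \<in> borel_measurable (natural_filtration t)"
    using Y Z by (simp_all add: adapted_control_def)
  then show "(\<lambda>\<omega>. f (Y \<omega> t) (Z \<omega> t)) \<in> borel_measurable (natural_filtration t)"
    using cont by (rule borel_measurable_continuous_Pair)
qed

lemma adapted_add_initial: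
  assumes "adapted_control Y" "0 \<le> a"
  shows "adapted_control (\<lambda>\<omega> t. Y \<omega> t + (if t < 0 then 0 else a))"
  unfolding adapted_control_def
proof (intro conjI ballI allI impI)
  fix \<omega> assume "\<omega> \<in> paths"
  then have "Y \<omega> \<in> controls" using assms(1) by (simp add: adapted_control_def)
  moreover have "(\<lambda>t. if t < 0 then 0 else a) \<in> controls" by (rule controls_cut) (use assms(2) in auto)
  ultimately show "(\<lambda>t. Y \<omega> t + (if t < 0 then 0 else a)) \<in> controls" by (rule controls_add)
next
  fix t :: real assume "0 \<le> t"
  then have [measurable]: "(\<lambda>\<omega>. Y \<omega> t) \<in> borel_measurable (natural_filtration t)"
    using assms(1) by (simp add: adapted_control_def)
  show "(\<lambda>\<omega>. Y \<omega> t + (if t < 0 then 0 else a)) \<in> borel_measurable (natural_filtration t)" by measurable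
qed

text \<open>
  The increments of the maximum and of the minimum of two cumulative processes that start at
  \<open>a\<close> and \<open>b\<close> and have increments \<open>y\<close> and \<open>z\<close>.
\<close>
definition join_incr :: "real \<Rightarrow> real \<Rightarrow> real \<Rightarrow> real \<Rightarrow> real" where
  "join_incr a b y z = max (a + y) (b + z) - max a b"

definition meet_incr :: "real \<Rightarrow> real \<Rightarrow> real \<Rightarrow> real \<Rightarrow> real" where
  "meet_incr a b y z = min (a + y) (b + z) - min a b"

lemma adapted_join: "adapted_control Y \<Longrightarrow> adapted_control Z \<Longrightarrow> adapted_control (\<lambda>\<omega> t. join_incr a b (Y \<omega> t) (Z \<omega> t))"
  by (rule adapted_combine[where f="join_incr a b"])
    (auto simp: join_incr_def intro!: continuous_intros max.mono)

lemma adapted_meet: "adapted_control Y \<Longrightarrow> adapted_control Z \<Longrightarrow> adapted_control (\<lambda>\<omega> t. meet_incr a b (Y \<omega> t) (Z \<omega> t))"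
  by (rule adapted_combine[where f="meet_incr a b"])
    (auto simp: meet_incr_def intro!: continuous_intros min.mono)

lemma join_meet_incr_add: "join_incr a b y z + meet_incr a b y z = y + z"
  by (auto simp: join_incr_def meet_incr_def max_def min_def)

lemma join_incr_le: "0 \<le> y \<Longrightarrow> 0 \<le> z \<Longrightarrow> join_incr a b y z \<le> y + z"
  and meet_incr_le: "0 \<le> y \<Longrightarrow> 0 \<le> z \<Longrightarrow> meet_incr a b y z \<le> y + z"
  by (auto simp: join_incr_def meet_incr_def max_def min_def)

text \<open>
  The way in which vanishing marginal costs are inherited: a nonnegative increment that is
  dominated by one of vanishing slope has vanishing slope.
\<close>
lemma has_derivative_zero_sandwich:
  fixes f g :: "real \<Rightarrow> real"
  assumes g: "(g has_real_derivative 0) (at 0 within {0..})"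
    and le: "\<And>a. 0 \<le> a \<Longrightarrow> f 0 \<le> f a" "\<And>a. 0 \<le> a \<Longrightarrow> f a - f 0 \<le> g a - g 0"
  shows "(f has_real_derivative 0) (at 0 within {0..})"
proof -
  have "((\<lambda>a. (g a - g 0) / (a - 0)) \<longlongrightarrow> 0) (at 0 within {0..})"
    using g unfolding has_field_derivative_iff .
  moreover have "\<forall>\<^sub>F a in at 0 within {0..}. norm ((f a - f 0) / (a - 0)) \<le> (g a - g 0) / (a - 0)"
    unfolding eventually_at_topological
  proof (intro exI[of _ UNIV] conjI ballI impI)
    fix a :: real assume "a \<noteq> 0" "a \<in> {0..}"
    then show "norm ((f a - f 0) / (a - 0)) \<le> (g a - g 0) / (a - 0)"
      using le[of a] by (simp add: divide_right_mono)
  qed auto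
  ultimately have "((\<lambda>a. (f a - f 0) / (a - 0)) \<longlongrightarrow> 0) (at 0 within {0..})"
    by (rule Lim_null_comparison[rotated])
  then show ?thesis unfolding has_field_derivative_iff .
qed

context admissible
begin

section \<open>Inequalities for the optimal cost\<close>

lemma law_total [simp]: "emeasure (law m) paths = 1"
  using law.emeasure_space_1 by simp

lemma discounted_measurable:
  assumes "adapted_control Y"
  shows "(\<lambda>\<omega>. discounted m (Y \<omega>)) \<in> borel_measurable (law m)"
proof -
  have [measurable]: "(\<lambda>p. Y (fst p) (snd p)) \<in> borel_measurable (law m \<Otimes>\<^sub>M lborel)"
    using adapted_pair_measurable[OF assms] by (simp add: case_prod_beta')
  have meas: "(\<lambda>\<omega>. \<integral>\<^sup>+t. ennreal (\<gamma> * exp (- \<gamma> * t) * Y \<omega> t) * indicator {0..} t \<partial>lborel) \<in> borel_measurable (law m)"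
  proof (rule lborel.borel_measurable_nn_integral)
    show "(\<lambda>(\<omega>, t). ennreal (\<gamma> * exp (- \<gamma> * t) * Y \<omega> t) * indicator {0..} t) \<in> borel_measurable (law m \<Otimes>\<^sub>M lborel)"
      unfolding case_prod_beta' by measurable
  qed
  have eq: "discounted m (Y \<omega>) = (\<integral>\<^sup>+t\<in>{0..}. ennreal (\<gamma> * exp (- \<gamma> * t) * Y \<omega> t) \<partial>lborel)"
    if "\<omega> \<in> space (law m)" for \<omega>
    by (intro discounted_eq_nn_integral adapted_in_controls[OF assms] params) (use that in simp)
  show ?thesis by (rule measurable_cong[THEN iffD2, OF eq meas])
qed

lemma discounted_le:
  assumes Y: "Y \<in> controls" "Y1 \<in> controls" "Y2 \<in> controls" and c: "0 \<le> c"
    and le: "\<And>t. 0 \<le> t \<Longrightarrow> Y t \<le> Y1 t + Y2 t + c"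
  shows "discounted m Y \<le> discounted m Y1 + discounted m Y2 + ennreal c"
proof -
  let ?g = "\<lambda>t. \<gamma> * exp (- \<gamma> * t)"
  note [measurable] = control_measurable[OF Y(2)] control_measurable[OF Y(3)]
  have g0: "0 \<le> ?g t" for t using params(2) by simp
  have "discounted m Y = (\<integral>\<^sup>+t\<in>{0..}. ennreal (?g t * Y t) \<partial>lborel)"
    by (rule discounted_eq_nn_integral[OF Y(1) params(2)])
  also have "\<dots> \<le> (\<integral>\<^sup>+t. (ennreal (?g t * Y1 t) * indicator {0..} t + ennreal (?g t * Y2 t) * indicator {0..} t
      + ennreal c * (ennreal (?g t) * indicator {0..} t)) \<partial>lborel)"
  proof (rule nn_integral_mono)
    fix t :: real
    show "ennreal (?g t * Y t) * indicator {0..} t \<le> ennreal (?g t * Y1 t) * indicator {0..} t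
      + ennreal (?g t * Y2 t) * indicator {0..} t + ennreal c * (ennreal (?g t) * indicator {0..} t)"
    proof (cases "0 \<le> t")
      case True
      have "?g t * Y t \<le> ?g t * (Y1 t + Y2 t + c)" by (intro mult_left_mono le[OF True] g0)
      then have "ennreal (?g t * Y t) \<le> ennreal (?g t * Y1 t + ?g t * Y2 t + c * ?g t)"
        by (intro ennreal_leI) (simp add: algebra_simps)
      also have "\<dots> = ennreal (?g t * Y1 t) + ennreal (?g t * Y2 t) + ennreal c * ennreal (?g t)"
        using g0[of t] c controls_nonneg[OF Y(2), of t] controls_nonneg[OF Y(3), of t]
        by (simp add: ennreal_plus ennreal_mult' mult_nonneg_nonneg)
      finally show ?thesis using True by simp
    qed simp
  qed
  also have "\<dots> = discounted m Y1 + discounted m Y2 + ennreal c * (\<integral>\<^sup>+t\<in>{0..}. ennreal (?g t) \<partial>lborel)"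
    unfolding discounted_eq_nn_integral[OF Y(2) params(2)] discounted_eq_nn_integral[OF Y(3) params(2)]
    by (simp add: nn_integral_add nn_integral_cmult)
  also have "(\<integral>\<^sup>+t\<in>{0..}. ennreal (?g t) \<partial>lborel) = 1"
    using nn_integral_exp_tail[OF params(2), of 0] by simp
  finally show ?thesis by simp
qed

text \<open>
  All new policies below have controls bounded by sums of the given ones and a constant, hence
  have finite expected discounted adjustments.
\<close>
lemma policies_dominated:
  assumes ad: "adapted_control A" "adapted_control B"
    and P: "(A1, B1) \<in> policies m" "(A2, B2) \<in> policies m" and c: "0 \<le> a" "0 \<le> b"
    and A: "\<And>\<omega> t. \<omega> \<in> paths \<Longrightarrow> 0 \<le> t \<Longrightarrow> A \<omega> t \<le> A1 \<omega> t + A2 \<omega> t + a"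
    and B: "\<And>\<omega> t. \<omega> \<in> paths \<Longrightarrow> 0 \<le> t \<Longrightarrow> B \<omega> t \<le> B1 \<omega> t + B2 \<omega> t + b"
  shows "(A, B) \<in> policies m"
proof -
  let ?d = "discounted m"
  have ad': "adapted_control A1" "adapted_control B1" "adapted_control A2" "adapted_control B2"
    and fin: "(\<integral>\<^sup>+\<omega>. (?d (A1 \<omega>) + ?d (B1 \<omega>)) \<partial>law m) < \<infinity>" "(\<integral>\<^sup>+\<omega>. (?d (A2 \<omega>) + ?d (B2 \<omega>)) \<partial>law m) < \<infinity>"
    using P by (auto simp: policies_def)
  note [measurable] = ad'[THEN discounted_measurable]
  have "(\<integral>\<^sup>+\<omega>. (?d (A \<omega>) + ?d (B \<omega>)) \<partial>law m)
    \<le> (\<integral>\<^sup>+\<omega>. ((?d (A1 \<omega>) + ?d (B1 \<omega>)) + (?d (A2 \<omega>) + ?d (B2 \<omega>)) + (ennreal a + ennreal b)) \<partial>law m)"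
  proof (rule nn_integral_mono)
    fix \<omega> assume "\<omega> \<in> space (law m)"
    then have \<omega>: "\<omega> \<in> paths" by simp
    have "?d (A \<omega>) \<le> ?d (A1 \<omega>) + ?d (A2 \<omega>) + ennreal a"
      by (intro discounted_le A[OF \<omega>] c adapted_in_controls[OF _ \<omega>] ad ad')
    moreover have "?d (B \<omega>) \<le> ?d (B1 \<omega>) + ?d (B2 \<omega>) + ennreal b"
      by (intro discounted_le B[OF \<omega>] c adapted_in_controls[OF _ \<omega>] ad ad')
    ultimately have "?d (A \<omega>) + ?d (B \<omega>)
      \<le> (?d (A1 \<omega>) + ?d (A2 \<omega>) + ennreal a) + (?d (B1 \<omega>) + ?d (B2 \<omega>) + ennreal b)"
      by (rule add_mono)
    then show "?d (A \<omega>) + ?d (B \<omega>) \<le> (?d (A1 \<omega>) + ?d (B1 \<omega>)) + (?d (A2 \<omega>) + ?d (B2 \<omega>)) + (ennreal a + ennreal b)"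
      by (simp add: ac_simps)
  qed
  also have "\<dots> = (\<integral>\<^sup>+\<omega>. (?d (A1 \<omega>) + ?d (B1 \<omega>)) \<partial>law m) + (\<integral>\<^sup>+\<omega>. (?d (A2 \<omega>) + ?d (B2 \<omega>)) \<partial>law m)
      + (ennreal a + ennreal b)"
    by (simp add: nn_integral_add)
  also have "\<dots> < \<infinity>" using fin by (simp add: ennreal_add_less_top less_top[symmetric])
  finally show ?thesis using ad by (simp add: policies_def)
qed

lemma path_cost_le_add:
  assumes "X \<in> states m" "adapted_control A" "adapted_control B" "\<omega> \<in> paths" and c: "0 \<le> c"
    and le: "\<And>t. 0 \<le> t \<Longrightarrow> cost_rate X' \<omega> A' B' t \<le> cost_rate X \<omega> (A \<omega>) (B \<omega>) t + c * (\<gamma> * exp (- \<gamma> * t))"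
  shows "path_cost X' \<omega> A' B' \<le> path_cost X \<omega> (A \<omega>) (B \<omega>) + ennreal c"
proof -
  let ?g = "\<lambda>t. \<gamma> * exp (- \<gamma> * t)"
  note [measurable] = path_section_measurable[OF cost_rate_measurable[OF assms(1-3)] assms(4)]
  have r0: "0 \<le> cost_rate X \<omega> (A \<omega>) (B \<omega>) t" for t
    by (rule cost_rate_nonneg[OF adapted_in_controls[OF assms(2,4)] adapted_in_controls[OF assms(3,4)]])
  have "path_cost X' \<omega> A' B'
      \<le> (\<integral>\<^sup>+t. (ennreal (cost_rate X \<omega> (A \<omega>) (B \<omega>) t) * indicator {0..} t + ennreal c * (ennreal (?g t) * indicator {0..} t)) \<partial>lborel)"
    unfolding path_cost_def
  proof (rule nn_integral_mono)
    fix t :: real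
    show "ennreal (cost_rate X' \<omega> A' B' t) * indicator {0..} t
      \<le> ennreal (cost_rate X \<omega> (A \<omega>) (B \<omega>) t) * indicator {0..} t + ennreal c * (ennreal (?g t) * indicator {0..} t)"
    proof (cases "0 \<le> t")
      case True
      have "ennreal (cost_rate X' \<omega> A' B' t) \<le> ennreal (cost_rate X \<omega> (A \<omega>) (B \<omega>) t + c * ?g t)"
        by (rule ennreal_leI[OF le[OF True]])
      also have "\<dots> = ennreal (cost_rate X \<omega> (A \<omega>) (B \<omega>) t) + ennreal c * ennreal (?g t)"
        using r0[of t] c params(2) by (simp add: ennreal_plus ennreal_mult' mult_nonneg_nonneg)
      finally show ?thesis using True by simp
    qed simp
  qed
  also have "\<dots> = path_cost X \<omega> (A \<omega>) (B \<omega>) + ennreal c * (\<integral>\<^sup>+t\<in>{0..}. ennreal (?g t) \<partial>lborel)"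
    unfolding path_cost_def by (simp add: nn_integral_add nn_integral_cmult)
  also have "(\<integral>\<^sup>+t\<in>{0..}. ennreal (?g t) \<partial>lborel) = 1"
    using nn_integral_exp_tail[OF params(2), of 0] by simp
  finally show ?thesis by simp
qed

lemma policy_cost_le_add:
  assumes "X \<in> states m" "X' \<in> states m" "adapted_control A" "adapted_control B" "adapted_control A'" "adapted_control B'"
    and c: "0 \<le> c"
    and le: "\<And>\<omega> t. \<omega> \<in> paths \<Longrightarrow> 0 \<le> t \<Longrightarrow>
      cost_rate X' \<omega> (A' \<omega>) (B' \<omega>) t \<le> cost_rate X \<omega> (A \<omega>) (B \<omega>) t + c * (\<gamma> * exp (- \<gamma> * t))"
  shows "policy_cost m X' (A', B') \<le> policy_cost m X (A, B) + ennreal c"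
proof -
  have "policy_cost m X' (A', B') \<le> (\<integral>\<^sup>+\<omega>. (path_cost X \<omega> (A \<omega>) (B \<omega>) + ennreal c) \<partial>law m)"
    unfolding policy_cost_eq[OF assms(2,5,6)]
    using assms by (intro nn_integral_mono path_cost_le_add) auto
  also have "\<dots> = policy_cost m X (A, B) + ennreal c"
    unfolding policy_cost_eq[OF assms(1,3,4)]
    using path_cost_measurable[OF assms(1,3,4)] by (simp add: nn_integral_add)
  finally show ?thesis .
qed

definition inf_cost :: "(real \<Rightarrow> real) \<Rightarrow> ennreal" where
  "inf_cost X = (INF \<pi>\<in>policies m. policy_cost m X \<pi>)"

lemma opt_cost_eq: "opt_cost m X = enn2real (inf_cost X)"
  by (simp add: opt_cost_def inf_cost_def)

text \<open>
  A policy may begin with adjustments by \<open>a\<close> and \<open>b\<close> at time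
  \<open>0\<close> and then follow any policy for the adjusted state.
\<close>
lemma inf_cost_le_adjust:
  assumes X: "X \<in> states m" and ab: "0 \<le> a" "0 \<le> b"
  shows "inf_cost X \<le> inf_cost (adjust m a b X) + ennreal (k_up m * a + k_down m * b)"
proof -
  let ?c = "k_up m * a + k_down m * b"
  have c: "0 \<le> ?c" using ab params by simp
  have "inf_cost X \<le> inf_cost (adjust m a b X) + (INF u\<in>{()}. ennreal ?c)"
    unfolding inf_cost_def[of "adjust m a b X"]
  proof (rule le_INF_add_INF_ennreal)
    fix \<pi> and u :: unit assume \<pi>: "\<pi> \<in> policies m"
    obtain A B where [simp]: "\<pi> = (A, B)" by force
    have ad: "adapted_control A" "adapted_control B" using \<pi> by (auto simp: policies_def)
    define A' where "A' \<omega> t = A \<omega> t + (if t < 0 then 0 else a)" for \<omega> t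
    define B' where "B' \<omega> t = B \<omega> t + (if t < 0 then 0 else b)" for \<omega> t
    have ad': "adapted_control A'" "adapted_control B'"
      unfolding A'_def B'_def using ad ab by (auto intro: adapted_add_initial)
    have P: "(A', B') \<in> policies m"
    proof (rule policies_dominated[OF ad' _ _ ab])
      fix \<omega> :: "real \<Rightarrow> real" and t :: real assume "\<omega> \<in> paths" "0 \<le> t"
      then show "A' \<omega> t \<le> A \<omega> t + A \<omega> t + a" "B' \<omega> t \<le> B \<omega> t + B \<omega> t + b"
        using controls_nonneg[OF adapted_in_controls[OF ad(1)], of \<omega> t]
          controls_nonneg[OF adapted_in_controls[OF ad(2)], of \<omega> t] by (simp_all add: A'_def B'_def)
    qed (use \<pi> in auto)
    have "inf_cost X \<le> policy_cost m X (A', B')" unfolding inf_cost_def using P by (rule INF_lower)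
    also have "\<dots> \<le> policy_cost m (adjust m a b X) (A, B) + ennreal ?c"
    proof (rule policy_cost_le_add[OF adjust_in_states[OF X ab(1) params(1)] X ad ad' c])
      fix \<omega> :: "real \<Rightarrow> real" and t :: real assume "\<omega> \<in> paths" "0 \<le> t"
      then have "net_inventory X \<omega> (A' \<omega>) (B' \<omega>) t = net_inventory (adjust m a b X) \<omega> (A \<omega>) (B \<omega>) t"
        by (auto simp: net_inventory_def A'_def B'_def adjust_def indicator_def)
      then show "cost_rate X \<omega> (A' \<omega>) (B' \<omega>) t \<le> cost_rate (adjust m a b X) \<omega> (A \<omega>) (B \<omega>) t + ?c * (\<gamma> * exp (- \<gamma> * t))"
        using \<open>0 \<le> t\<close> by (simp add: cost_rate_def A'_def B'_def algebra_simps)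
    qed
    finally show "inf_cost X \<le> policy_cost m (adjust m a b X) \<pi> + ennreal ?c" by simp
  qed
  then show ?thesis by simp
qed

text \<open>
  Two states differ by a bounded function, so by the Lipschitz bound on the holding cost the same
  policy has costs that differ by a finite amount.
\<close>
lemma inf_cost_finite_transfer:
  assumes X: "X \<in> states m" and X': "X' \<in> states m" and fin: "inf_cost X < \<infinity>"
  shows "inf_cost X' < \<infinity>"
proof -
  obtain A B where AB: "(A, B) \<in> policies m" "policy_cost m X (A, B) < \<infinity>"
    using fin unfolding inf_cost_def INF_less_iff by force
  then have ad: "adapted_control A" "adapted_control B" by (auto simp: policies_def)
  define D where "D = \<bar>X 0\<bar> + \<bar>X (lead m)\<bar> + \<bar>X' 0\<bar> + \<bar>X' (lead m)\<bar>"
  have D: "\<bar>X' t - X t\<bar> \<le> D" if "0 \<le> t" for t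
    using states_mono[OF X _ that] states_mono[OF X' _ that] states_le_position[OF X that] states_le_position[OF X' that]
    unfolding D_def by fastforce
  have MD: "0 \<le> slope_bound m * D / \<gamma>" using slope_pos params(2) by (auto simp: D_def intro!: divide_nonneg_pos mult_nonneg_nonneg)
  have "policy_cost m X' (A, B) \<le> policy_cost m X (A, B) + ennreal (slope_bound m * D / \<gamma>)"
  proof (rule policy_cost_le_add[OF X X' ad ad MD])
    fix \<omega> :: "real \<Rightarrow> real" and t :: real assume "\<omega> \<in> paths" and t: "0 \<le> t"
    have "net_inventory X' \<omega> (A \<omega>) (B \<omega>) t - net_inventory X \<omega> (A \<omega>) (B \<omega>) t = X' t - X t"
      using t by (simp add: net_inventory_def max_def)
    then have "h (net_inventory X' \<omega> (A \<omega>) (B \<omega>) t) - h (net_inventory X \<omega> (A \<omega>) (B \<omega>) t) \<le> slope_bound m * \<bar>X' t - X t\<bar>"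
      using h_lipschitz[of "net_inventory X' \<omega> (A \<omega>) (B \<omega>) t" "net_inventory X \<omega> (A \<omega>) (B \<omega>) t"] by simp
    also have "\<dots> \<le> slope_bound m * D" using D[OF t] slope_pos by simp
    finally have "exp (- \<gamma> * t) * h (net_inventory X' \<omega> (A \<omega>) (B \<omega>) t)
        \<le> exp (- \<gamma> * t) * (h (net_inventory X \<omega> (A \<omega>) (B \<omega>) t) + slope_bound m * D)"
      by (intro mult_left_mono) auto
    then show "cost_rate X' \<omega> (A \<omega>) (B \<omega>) t
        \<le> cost_rate X \<omega> (A \<omega>) (B \<omega>) t + slope_bound m * D / \<gamma> * (\<gamma> * exp (- \<gamma> * t))"
      using params(2) by (simp add: cost_rate_def algebra_simps)
  qed
  also have "\<dots> < \<infinity>" using AB(2) by (simp add: ennreal_add_less_top)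
  finally show ?thesis unfolding inf_cost_def using AB(1) by (auto simp: INF_less_iff)
qed

text \<open>
  With cumulative supplies \<open>U1\<close>, \<open>U2\<close> and cumulative removals
  \<open>D1\<close>, \<open>D2\<close>, the differences \<open>max U1 U2 - max D1 D2\<close>
  and \<open>min U1 U2 - min D1 D2\<close> lie between \<open>U1 - D1\<close> and
  \<open>U2 - D2\<close> and have the same sum, so convexity applies to the holding cost. The
  adjustment costs of the two sides agree.
\<close>
lemma cost_rate_lattice:
  assumes X: "X1 \<in> states m" "X2 \<in> states m" and "0 \<le> t"
    and c: "A1 \<in> controls" "A2 \<in> controls"
    and V: "V t = max (X1 t) (X2 t) - max d1 d2" and W: "W t = min (X1 t) (X2 t) - min d1 d2"
  shows "cost_rate V \<omega> (\<lambda>t. join_incr (X1 (lead m)) (X2 (lead m)) (A1 t) (A2 t)) (\<lambda>t. join_incr d1 d2 (B1 t) (B2 t)) t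
      + cost_rate W \<omega> (\<lambda>t. meet_incr (X1 (lead m)) (X2 (lead m)) (A1 t) (A2 t)) (\<lambda>t. meet_incr d1 d2 (B1 t) (B2 t)) t
      \<le> cost_rate (\<lambda>u. X1 u - d1) \<omega> A1 B1 t + cost_rate (\<lambda>u. X2 u - d2) \<omega> A2 B2 t"
    (is "cost_rate V \<omega> ?A ?B t + cost_rate W \<omega> ?A' ?B' t \<le> cost_rate ?X1 \<omega> A1 B1 t + cost_rate ?X2 \<omega> A2 B2 t")
proof -
  define U1 U2 D1 D2 where "U1 = X1 t + A1 (t - lead m)" and "U2 = X2 t + A2 (t - lead m)"
    and "D1 = d1 + B1 t" and "D2 = d2 + B2 t"
  note UD = U1_def U2_def D1_def D2_def
  have U: "max (X1 t) (X2 t) + ?A (t - lead m) = max U1 U2" "min (X1 t) (X2 t) + ?A' (t - lead m) = min U1 U2"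
  proof -
    have "A1 (t - lead m) = 0 \<and> A2 (t - lead m) = 0 \<or> X1 t = X1 (lead m) \<and> X2 t = X2 (lead m)"
      using controls_zero[OF c(1), of "t - lead m"] controls_zero[OF c(2), of "t - lead m"]
        states_const[OF X(1), of t] states_const[OF X(2), of t]
      by (cases "t < lead m") simp_all
    then show "max (X1 t) (X2 t) + ?A (t - lead m) = max U1 U2" "min (X1 t) (X2 t) + ?A' (t - lead m) = min U1 U2"
      by (auto simp: join_incr_def meet_incr_def UD)
  qed
  have n: "net_inventory V \<omega> ?A ?B t = \<omega> t + max U1 U2 - max D1 D2" "net_inventory W \<omega> ?A' ?B' t = \<omega> t + min U1 U2 - min D1 D2"
    "net_inventory ?X1 \<omega> A1 B1 t = \<omega> t + U1 - D1" "net_inventory ?X2 \<omega> A2 B2 t = \<omega> t + U2 - D2"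
    unfolding U[symmetric] using \<open>0 \<le> t\<close> by (simp_all add: net_inventory_def V W join_incr_def meet_incr_def UD max_absorb2)
  have "h (net_inventory V \<omega> ?A ?B t) + h (net_inventory W \<omega> ?A' ?B' t) \<le> h (net_inventory ?X1 \<omega> A1 B1 t) + h (net_inventory ?X2 \<omega> A2 B2 t)"
    unfolding n by (rule convex_on_sum_between[OF h_convex]) (auto simp: max_def min_def)
  then have "exp (- \<gamma> * t) * (h (net_inventory V \<omega> ?A ?B t) + h (net_inventory W \<omega> ?A' ?B' t))
      \<le> exp (- \<gamma> * t) * (h (net_inventory ?X1 \<omega> A1 B1 t) + h (net_inventory ?X2 \<omega> A2 B2 t))"
    by (rule mult_left_mono) simp
  moreover have "k_up m * ?A t + k_up m * ?A' t = k_up m * A1 t + k_up m * A2 t"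
    "k_down m * ?B t + k_down m * ?B' t = k_down m * B1 t + k_down m * B2 t"
    using join_meet_incr_add by (metis distrib_left)+
  then have "(k_up m * ?A t + k_down m * ?B t) + (k_up m * ?A' t + k_down m * ?B' t)
    = (k_up m * A1 t + k_down m * B1 t) + (k_up m * A2 t + k_down m * B2 t)"
    by linarith
  then have "\<gamma> * (k_up m * ?A t + k_down m * ?B t) + \<gamma> * (k_up m * ?A' t + k_down m * ?B' t)
    = \<gamma> * (k_up m * A1 t + k_down m * B1 t) + \<gamma> * (k_up m * A2 t + k_down m * B2 t)"
    by (metis distrib_left)
  then have "exp (- \<gamma> * t) * (\<gamma> * (k_up m * ?A t + k_down m * ?B t) + \<gamma> * (k_up m * ?A' t + k_down m * ?B' t))
    = exp (- \<gamma> * t) * (\<gamma> * (k_up m * A1 t + k_down m * B1 t) + \<gamma> * (k_up m * A2 t + k_down m * B2 t))"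
    by simp
  ultimately show ?thesis unfolding cost_rate_def distrib_left by linarith
qed

text \<open>
  The supplies start from the states \<open>X1\<close> and \<open>X2\<close>, the removals from
  the offsets \<open>d1\<close> and \<open>d2\<close>. Lowering a state by \<open>d\<close> is the
  same as starting its removal process at \<open>d\<close>, and this freedom lets the inequality
  compare states that are ordered, for which the plain submodular inequality is trivial.
\<close>
lemma inf_cost_lattice:
  assumes X: "X1 \<in> states m" "X2 \<in> states m" and VW: "V \<in> states m" "W \<in> states m"
    and V: "\<And>t. 0 \<le> t \<Longrightarrow> V t = max (X1 t) (X2 t) - max d1 d2"
    and W: "\<And>t. 0 \<le> t \<Longrightarrow> W t = min (X1 t) (X2 t) - min d1 d2"
  shows "inf_cost V + inf_cost W \<le> inf_cost (\<lambda>u. X1 u - d1) + inf_cost (\<lambda>u. X2 u - d2)"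
  unfolding inf_cost_def[of "\<lambda>u. X1 u - d1"] inf_cost_def[of "\<lambda>u. X2 u - d2"]
proof (rule le_INF_add_INF_ennreal)
  fix \<pi>1 \<pi>2 assume \<pi>: "\<pi>1 \<in> policies m" "\<pi>2 \<in> policies m"
  obtain A1 B1 A2 B2 where [simp]: "\<pi>1 = (A1, B1)" "\<pi>2 = (A2, B2)" by force
  have ad: "adapted_control A1" "adapted_control B1" "adapted_control A2" "adapted_control B2"
    using \<pi> by (auto simp: policies_def)
  have XX: "(\<lambda>u. X1 u - d1) \<in> states m" "(\<lambda>u. X2 u - d2) \<in> states m"
    using states_add_const[OF X(1), of "- d1"] states_add_const[OF X(2), of "- d2"] by simp_all
  define A B A' B' where
    "A \<omega> t = join_incr (X1 (lead m)) (X2 (lead m)) (A1 \<omega> t) (A2 \<omega> t)" and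
    "B \<omega> t = join_incr d1 d2 (B1 \<omega> t) (B2 \<omega> t)" and
    "A' \<omega> t = meet_incr (X1 (lead m)) (X2 (lead m)) (A1 \<omega> t) (A2 \<omega> t)" and
    "B' \<omega> t = meet_incr d1 d2 (B1 \<omega> t) (B2 \<omega> t)" for \<omega> t
  have ad': "adapted_control A" "adapted_control B" "adapted_control A'" "adapted_control B'"
    unfolding A_def B_def A'_def B'_def by (intro adapted_join adapted_meet ad)+
  have nn: "0 \<le> A1 \<omega> t" "0 \<le> B1 \<omega> t" "0 \<le> A2 \<omega> t" "0 \<le> B2 \<omega> t" if "\<omega> \<in> paths" for \<omega> t
    using ad[THEN adapted_in_controls, OF that] by (simp_all add: controls_nonneg)
  have \<pi>': "(A1, B1) \<in> policies m" "(A2, B2) \<in> policies m" using \<pi> by simp_all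
  have P: "(A, B) \<in> policies m"
    by (rule policies_dominated[OF ad'(1,2) \<pi>' order_refl order_refl])
      (simp_all add: A_def B_def join_incr_le nn)
  have P': "(A', B') \<in> policies m"
    by (rule policies_dominated[OF ad'(3,4) \<pi>' order_refl order_refl])
      (simp_all add: A'_def B'_def meet_incr_le nn)
  have "inf_cost V + inf_cost W \<le> policy_cost m V (A, B) + policy_cost m W (A', B')"
    unfolding inf_cost_def by (intro add_mono INF_lower P P')
  also have "\<dots> = (\<integral>\<^sup>+\<omega>. (path_cost V \<omega> (A \<omega>) (B \<omega>) + path_cost W \<omega> (A' \<omega>) (B' \<omega>)) \<partial>law m)"
    unfolding policy_cost_eq[OF VW(1) ad'(1,2)] policy_cost_eq[OF VW(2) ad'(3,4)]
    by (intro nn_integral_add[symmetric] path_cost_measurable VW ad')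
  also have "\<dots> \<le> (\<integral>\<^sup>+\<omega>. (path_cost (\<lambda>u. X1 u - d1) \<omega> (A1 \<omega>) (B1 \<omega>) + path_cost (\<lambda>u. X2 u - d2) \<omega> (A2 \<omega>) (B2 \<omega>)) \<partial>law m)"
  proof (rule nn_integral_mono)
    fix \<omega> assume "\<omega> \<in> space (law m)"
    then have \<omega>: "\<omega> \<in> paths" by simp
    have c: "A \<omega> \<in> controls" "B \<omega> \<in> controls" "A' \<omega> \<in> controls" "B' \<omega> \<in> controls"
      "A1 \<omega> \<in> controls" "B1 \<omega> \<in> controls" "A2 \<omega> \<in> controls" "B2 \<omega> \<in> controls"
      by (fact ad[THEN adapted_in_controls, OF \<omega>] ad'[THEN adapted_in_controls, OF \<omega>])+
    note [measurable] = path_section_measurable[OF cost_rate_measurable[OF VW(1) ad'(1,2)] \<omega>]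
      path_section_measurable[OF cost_rate_measurable[OF VW(2) ad'(3,4)] \<omega>]
      path_section_measurable[OF cost_rate_measurable[OF XX(1) ad(1,2)] \<omega>]
      path_section_measurable[OF cost_rate_measurable[OF XX(2) ad(3,4)] \<omega>]
    have "path_cost V \<omega> (A \<omega>) (B \<omega>) + path_cost W \<omega> (A' \<omega>) (B' \<omega>)
      = (\<integral>\<^sup>+t. (ennreal (cost_rate V \<omega> (A \<omega>) (B \<omega>) t) * indicator {0..} t
          + ennreal (cost_rate W \<omega> (A' \<omega>) (B' \<omega>) t) * indicator {0..} t) \<partial>lborel)"
      unfolding path_cost_def by (simp add: nn_integral_add)
    also have "\<dots> \<le> (\<integral>\<^sup>+t. (ennreal (cost_rate (\<lambda>u. X1 u - d1) \<omega> (A1 \<omega>) (B1 \<omega>) t) * indicator {0..} t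
          + ennreal (cost_rate (\<lambda>u. X2 u - d2) \<omega> (A2 \<omega>) (B2 \<omega>) t) * indicator {0..} t) \<partial>lborel)"
    proof (rule nn_integral_mono)
      fix t :: real
      show "ennreal (cost_rate V \<omega> (A \<omega>) (B \<omega>) t) * indicator {0..} t
          + ennreal (cost_rate W \<omega> (A' \<omega>) (B' \<omega>) t) * indicator {0..} t
        \<le> ennreal (cost_rate (\<lambda>u. X1 u - d1) \<omega> (A1 \<omega>) (B1 \<omega>) t) * indicator {0..} t
          + ennreal (cost_rate (\<lambda>u. X2 u - d2) \<omega> (A2 \<omega>) (B2 \<omega>) t) * indicator {0..} t"
      proof (cases "0 \<le> t")
        case True
        have "cost_rate V \<omega> (A \<omega>) (B \<omega>) t + cost_rate W \<omega> (A' \<omega>) (B' \<omega>) t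
          \<le> cost_rate (\<lambda>u. X1 u - d1) \<omega> (A1 \<omega>) (B1 \<omega>) t + cost_rate (\<lambda>u. X2 u - d2) \<omega> (A2 \<omega>) (B2 \<omega>) t"
          unfolding A_def B_def A'_def B'_def
          by (rule cost_rate_lattice[where t=t and V=V and W=W]) (fact X True c V[OF True] W[OF True])+
        then show ?thesis
          using True cost_rate_nonneg[OF c(1,2), of V \<omega> t] cost_rate_nonneg[OF c(3,4), of W \<omega> t]
            cost_rate_nonneg[OF c(5,6), of "\<lambda>u. X1 u - d1" \<omega> t] cost_rate_nonneg[OF c(7,8), of "\<lambda>u. X2 u - d2" \<omega> t]
          by (simp add: ennreal_plus[symmetric] ennreal_leI del: ennreal_plus)
      qed simp
    qed
    also have "\<dots> = path_cost (\<lambda>u. X1 u - d1) \<omega> (A1 \<omega>) (B1 \<omega>) + path_cost (\<lambda>u. X2 u - d2) \<omega> (A2 \<omega>) (B2 \<omega>)"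
      unfolding path_cost_def by (simp add: nn_integral_add)
    finally show "path_cost V \<omega> (A \<omega>) (B \<omega>) + path_cost W \<omega> (A' \<omega>) (B' \<omega>)
      \<le> path_cost (\<lambda>u. X1 u - d1) \<omega> (A1 \<omega>) (B1 \<omega>) + path_cost (\<lambda>u. X2 u - d2) \<omega> (A2 \<omega>) (B2 \<omega>)" .
  qed
  also have "\<dots> = policy_cost m (\<lambda>u. X1 u - d1) \<pi>1 + policy_cost m (\<lambda>u. X2 u - d2) \<pi>2"
    unfolding \<open>\<pi>1 = (A1, B1)\<close> \<open>\<pi>2 = (A2, B2)\<close> policy_cost_eq[OF XX(1) ad(1,2)] policy_cost_eq[OF XX(2) ad(3,4)]
    by (intro nn_integral_add path_cost_measurable XX ad)
  finally show "inf_cost V + inf_cost W \<le> policy_cost m (\<lambda>u. X1 u - d1) \<pi>1 + policy_cost m (\<lambda>u. X2 u - d2) \<pi>2" .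
qed

text \<open>
  The dichotomy transfers the inequalities to real-valued costs, where an infinite cost would
  become \<open>0\<close>: the cost is either finite for all states or \<open>0\<close> for all of
  them.
\<close>
lemma inf_cost_finite_or_infinite: "(\<forall>X\<in>states m. inf_cost X < \<infinity>) \<or> (\<forall>X\<in>states m. inf_cost X = \<infinity>)"
  using inf_cost_finite_transfer by (metis infinity_ennreal_def less_top)

lemma opt_cost_lattice:
  assumes X: "X1 \<in> states m" "X2 \<in> states m" and VW: "V \<in> states m" "W \<in> states m"
    and V: "\<And>t. 0 \<le> t \<Longrightarrow> V t = max (X1 t) (X2 t) - max d1 d2"
    and W: "\<And>t. 0 \<le> t \<Longrightarrow> W t = min (X1 t) (X2 t) - min d1 d2"
  shows "opt_cost m V + opt_cost m W \<le> opt_cost m (\<lambda>u. X1 u - d1) + opt_cost m (\<lambda>u. X2 u - d2)"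
proof -
  have XX: "(\<lambda>u. X1 u - d1) \<in> states m" "(\<lambda>u. X2 u - d2) \<in> states m"
    using states_add_const[OF X(1), of "- d1"] states_add_const[OF X(2), of "- d2"] by simp_all
  show ?thesis
    using inf_cost_finite_or_infinite
  proof
    assume "\<forall>X\<in>states m. inf_cost X < \<infinity>"
    then have fin: "inf_cost V < top" "inf_cost W < top" "inf_cost (\<lambda>u. X1 u - d1) < top" "inf_cost (\<lambda>u. X2 u - d2) < top"
      using VW XX by auto
    have "inf_cost V + inf_cost W \<le> inf_cost (\<lambda>u. X1 u - d1) + inf_cost (\<lambda>u. X2 u - d2)"
      by (rule inf_cost_lattice[OF X VW V W])
    moreover have "inf_cost (\<lambda>u. X1 u - d1) + inf_cost (\<lambda>u. X2 u - d2) < top"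
      using fin(3,4) unfolding ennreal_add_less_top by blast
    ultimately have "enn2real (inf_cost V + inf_cost W) \<le> enn2real (inf_cost (\<lambda>u. X1 u - d1) + inf_cost (\<lambda>u. X2 u - d2))"
      by (rule enn2real_mono)
    then show ?thesis using fin by (simp add: opt_cost_eq enn2real_plus)
  next
    assume "\<forall>X\<in>states m. inf_cost X = \<infinity>"
    then show ?thesis using VW XX by (simp add: opt_cost_eq)
  qed
qed

lemma opt_cost_le_adjusted:
  assumes X: "X \<in> states m" and ab: "0 \<le> a" "0 \<le> b"
  shows "opt_cost m X \<le> adjusted_cost m X a b"
proof -
  have aX: "adjust m a b X \<in> states m" by (rule adjust_in_states[OF X ab(1) params(1)])
  have c: "0 \<le> k_up m * a + k_down m * b" using ab params by simp
  show ?thesis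
    using inf_cost_finite_or_infinite
  proof
    assume "\<forall>X\<in>states m. inf_cost X < \<infinity>"
    then have fin: "inf_cost (adjust m a b X) < top" using aX by auto
    have "inf_cost (adjust m a b X) + ennreal (k_up m * a + k_down m * b) < top"
      using fin unfolding ennreal_add_less_top by simp
    with inf_cost_le_adjust[OF assms]
    have "enn2real (inf_cost X) \<le> enn2real (inf_cost (adjust m a b X) + ennreal (k_up m * a + k_down m * b))"
      by (rule enn2real_mono)
    then show ?thesis using fin c by (simp add: opt_cost_eq enn2real_plus adjusted_cost_def)
  next
    assume "\<forall>X\<in>states m. inf_cost X = \<infinity>"
    then show ?thesis using X aX c by (simp add: opt_cost_eq adjusted_cost_def)
  qed
qed

section \<open>Marginal costs and the action regions\<close>

lemma adjust_0: "adjust m 0 0 X = X"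
  by (simp add: adjust_def)

text \<open>
  The lattice inequality for \<open>X'\<close> with an order of size \<open>a\<close> and offset
  \<open>0\<close>, and for \<open>X\<close> raised by \<open>c\<close> with offset
  \<open>c\<close>, where \<open>c\<close> is the difference of the positions. The second state
  dominates the first before the lead time, and it is dominated from the lead time on.
\<close>
lemma marginal_up_mono:
  assumes X: "X \<in> states m" "X' \<in> states m" and pos: "X (lead m) \<le> X' (lead m)"
    and dom: "\<And>u. 0 \<le> u \<Longrightarrow> X' u - X u \<le> X' (lead m) - X (lead m)" and a: "0 \<le> a"
  shows "adjusted_cost m X a 0 - adjusted_cost m X 0 0 \<le> adjusted_cost m X' a 0 - adjusted_cost m X' 0 0"
proof -
  define c where "c = X' (lead m) - X (lead m)"
  have Xc: "(\<lambda>u. X u + c) \<in> states m" by (rule states_add_const[OF X(1)])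
  have "opt_cost m (adjust m a 0 X) + opt_cost m X'
      \<le> opt_cost m (\<lambda>u. adjust m a 0 X' u - 0) + opt_cost m (\<lambda>u. (X u + c) - c)"
  proof (rule opt_cost_lattice[OF adjust_in_states[OF X(2) a params(1)] Xc
        adjust_in_states[OF X(1) a params(1)] X(2)])
    fix t :: real assume t: "0 \<le> t"
    have eq: "X t = X (lead m)" "X' t = X' (lead m)" if "lead m \<le> t"
      by (rule states_const[OF X(1) that], rule states_const[OF X(2) that])
    show "adjust m a 0 X t = max (adjust m a 0 X' t) (X t + c) - max 0 c"
      using dom[OF t] pos a eq by (cases "lead m \<le> t") (auto simp: adjust_def c_def max_def)
    show "X' t = min (adjust m a 0 X' t) (X t + c) - min 0 c"
      using dom[OF t] pos a eq by (cases "lead m \<le> t") (auto simp: adjust_def c_def min_def)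
  qed
  then show ?thesis by (simp add: adjusted_cost_def adjust_0)
qed

text \<open>
  The lattice inequality for the higher state \<open>X'\<close> with offset \<open>0\<close> and
  the lower state \<open>X\<close> with offset \<open>b\<close>: the maximum of the offsets goes
  with the higher state.
\<close>
lemma marginal_down_antimono:
  assumes X: "X \<in> states m" "X' \<in> states m" and le: "\<And>u. 0 \<le> u \<Longrightarrow> X u \<le> X' u" and b: "0 \<le> b"
  shows "adjusted_cost m X' 0 b - adjusted_cost m X' 0 0 \<le> adjusted_cost m X 0 b - adjusted_cost m X 0 0"
proof -
  have "opt_cost m (adjust m 0 b X') + opt_cost m X \<le> opt_cost m (\<lambda>u. X' u - 0) + opt_cost m (\<lambda>u. X u - b)"
    by (rule opt_cost_lattice[OF X(2,1) adjust_in_states[OF X(2) order_refl params(1)] X(1)])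
      (use le b in \<open>simp_all add: adjust_def max_absorb1 min_absorb2\<close>)
  then show ?thesis by (simp add: adjusted_cost_def adjust_0 adjust_def)
qed

lemma w_up_mono:
  assumes X: "X \<in> states m" "X' \<in> states m" and pos: "X (lead m) \<le> X' (lead m)"
    and dom: "\<And>u. 0 \<le> u \<Longrightarrow> X' u - X u \<le> X' (lead m) - X (lead m)"
  shows "w_up m X' 0 \<le> w_up m X 0"
  unfolding w_up_def
proof (intro Sup_subset_mono image_mono subsetI CollectI)
  fix w assume "w \<in> {w. ((\<lambda>a. adjusted_cost m (\<lambda>u. X' (0 + u) + w) a 0) has_real_derivative 0) (at 0 within {0..})}"
  then have d: "((\<lambda>a. adjusted_cost m (\<lambda>u. X' u + w) a 0) has_real_derivative 0) (at 0 within {0..})" by simp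
  note Xw = states_add_const[OF X(1), of w] states_add_const[OF X(2), of w]
  have "((\<lambda>a. adjusted_cost m (\<lambda>u. X u + w) a 0) has_real_derivative 0) (at 0 within {0..})"
  proof (rule has_derivative_zero_sandwich[OF d])
    fix a :: real assume a: "0 \<le> a"
    show "adjusted_cost m (\<lambda>u. X u + w) 0 0 \<le> adjusted_cost m (\<lambda>u. X u + w) a 0"
      using opt_cost_le_adjusted[OF Xw(1) a order_refl] by (simp add: adjusted_cost_def[of m _ 0 0] adjust_0)
    show "adjusted_cost m (\<lambda>u. X u + w) a 0 - adjusted_cost m (\<lambda>u. X u + w) 0 0
        \<le> adjusted_cost m (\<lambda>u. X' u + w) a 0 - adjusted_cost m (\<lambda>u. X' u + w) 0 0"
      by (rule marginal_up_mono[OF Xw _ _ a]) (use pos dom in auto)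
  qed
  then show "((\<lambda>a. adjusted_cost m (\<lambda>u. X (0 + u) + w) a 0) has_real_derivative 0) (at 0 within {0..})" by simp
qed

lemma w_down_antimono:
  assumes X: "X \<in> states m" "X' \<in> states m" and le: "\<And>u. 0 \<le> u \<Longrightarrow> X u \<le> X' u"
  shows "w_down m X' 0 \<le> w_down m X 0"
  unfolding w_down_def
proof (intro Inf_superset_mono image_mono subsetI CollectI)
  fix w assume "w \<in> {w. ((\<lambda>b. adjusted_cost m (\<lambda>u. X (0 + u) + w) 0 b) has_real_derivative 0) (at 0 within {0..})}"
  then have d: "((\<lambda>b. adjusted_cost m (\<lambda>u. X u + w) 0 b) has_real_derivative 0) (at 0 within {0..})" by simp
  note Xw = states_add_const[OF X(1), of w] states_add_const[OF X(2), of w]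
  have "((\<lambda>b. adjusted_cost m (\<lambda>u. X' u + w) 0 b) has_real_derivative 0) (at 0 within {0..})"
  proof (rule has_derivative_zero_sandwich[OF d])
    fix b :: real assume b: "0 \<le> b"
    show "adjusted_cost m (\<lambda>u. X' u + w) 0 0 \<le> adjusted_cost m (\<lambda>u. X' u + w) 0 b"
      using opt_cost_le_adjusted[OF Xw(2) order_refl b] by (simp add: adjusted_cost_def[of m _ 0 0] adjust_0)
    show "adjusted_cost m (\<lambda>u. X' u + w) 0 b - adjusted_cost m (\<lambda>u. X' u + w) 0 0
        \<le> adjusted_cost m (\<lambda>u. X u + w) 0 b - adjusted_cost m (\<lambda>u. X u + w) 0 0"
      by (rule marginal_down_antimono[OF Xw _ b]) (use le in auto)
  qed
  then show "((\<lambda>b. adjusted_cost m (\<lambda>u. X' (0 + u) + w) 0 b) has_real_derivative 0) (at 0 within {0..})" by simp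
qed

text \<open>
  Adding a constant to the state translates the set of zeros that defines the threshold.
\<close>
lemma w_up_const_le:
  assumes "w_up m (\<lambda>_. 0) s < ereal c"
  shows "w_up m (\<lambda>_. c) 0 \<le> 0"
  unfolding w_up_def
proof (rule Sup_least, clarify)
  fix w assume "((\<lambda>a. adjusted_cost m (\<lambda>u. c + w) a 0) has_real_derivative 0) (at 0 within {0..})"
  then have "ereal (c + w) \<le> w_up m (\<lambda>_. 0) s"
    unfolding w_up_def by (intro Sup_upper) auto
  then have "ereal (c + w) < ereal c" using assms by (rule le_less_trans)
  then show "ereal w \<le> 0" by simp
qed

lemma w_down_const_ge:
  assumes "ereal c < w_down m (\<lambda>_. 0) s"
  shows "0 \<le> w_down m (\<lambda>_. c) 0"
  unfolding w_down_def
proof (rule Inf_greatest, clarify)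
  fix w assume "((\<lambda>b. adjusted_cost m (\<lambda>u. c + w) 0 b) has_real_derivative 0) (at 0 within {0..})"
  then have "w_down m (\<lambda>_. 0) s \<le> ereal (c + w)"
    unfolding w_down_def by (intro Inf_lower) auto
  then have "ereal c < ereal (c + w)" using assms by (rule less_le_trans[rotated])
  then show "0 \<le> ereal w" by simp
qed

text \<open>
  Both barriers arise by comparing a state with the constant state at its position, which
  dominates it and agrees with it from the lead time on.
\<close>
lemma two_barriers_of_gap:
  assumes p: "w_up m (\<lambda>_. 0) s < ereal p" and pq: "p < q" and q: "ereal q < w_down m (\<lambda>_. 0) s"
  shows "two_barriers m p q"
proof
  show "0 < lead m" "p < q" by (fact params(1) pq)+
next
  fix X assume X: "X \<in> states m" and "p \<le> X (lead m)"
  then have "w_up m (\<lambda>_. 0) s < ereal (X (lead m))" using p by (meson ereal_less_eq(3) less_le_trans)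
  then have "w_up m (\<lambda>_. X (lead m)) 0 \<le> 0" by (rule w_up_const_le)
  moreover have "w_up m X 0 \<le> w_up m (\<lambda>_. X (lead m)) 0"
    by (rule w_up_mono[OF const_in_states X]) (use states_le_position[OF X] in auto)
  ultimately show "X \<notin> states_up m" by (auto simp: states_up_def)
next
  fix X assume X: "X \<in> states m" and "X (lead m) \<le> q"
  then have "ereal (X (lead m)) < w_down m (\<lambda>_. 0) s" using q by (meson ereal_less_eq(3) le_less_trans)
  then have "0 \<le> w_down m (\<lambda>_. X (lead m)) 0" by (rule w_down_const_ge)
  moreover have "w_down m (\<lambda>_. X (lead m)) 0 \<le> w_down m X 0"
    by (rule w_down_antimono[OF X const_in_states]) (use states_le_position[OF X] in auto)
  ultimately show "X \<notin> states_down m" by (auto simp: states_down_def)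
next
  fix X X' assume X: "X \<in> states m" "X' \<in> states m" and "X \<notin> states_up m" "X (lead m) \<le> X' (lead m)"
    "\<And>u. 0 \<le> u \<Longrightarrow> X' u - X u \<le> X' (lead m) - X (lead m)"
  then show "X' \<notin> states_up m" using w_up_mono[OF X] by (force simp: states_up_def)
next
  fix X X' assume X: "X \<in> states m" "X' \<in> states m" and "X \<notin> states_down m"
    "\<And>u. 0 \<le> u \<Longrightarrow> X' u \<le> X u"
  then show "X' \<notin> states_down m" using w_down_antimono[OF X(2,1)] by (force simp: states_down_def)
qed

end

theorem proposition6p4:
  fixes m :: inventory_model and X \<omega> :: "real \<Rightarrow> real"
  assumes "admissible_model m"
    and "convex_differentiable_cost m"
    and "states_up m \<inter> states_down m = {}"
    and "w_down m (\<lambda>_. 0) (lead m) > w_up m (\<lambda>_. 0) (lead m)"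
    and "X \<in> states m"
    and "\<omega> \<in> paths" and "\<omega> 0 = 0"
  shows "\<exists>!Y. two_sided_reflection m X \<omega> Y"
proof -
  interpret admissible m by (rule admissible.intro) (rule assms(1))
  obtain p where p: "w_up m (\<lambda>_. 0) (lead m) < ereal p" "ereal p < w_down m (\<lambda>_. 0) (lead m)"
    using ereal_dense2[OF assms(4)] by blast
  obtain q where q: "ereal p < ereal q" "ereal q < w_down m (\<lambda>_. 0) (lead m)"
    using ereal_dense2[OF p(2)] by blast
  interpret two_barriers m p q
    using p(1) q by (intro two_barriers_of_gap) auto
  show ?thesis using assms(5,6) by (intro ex1_two_sided_reflection) (auto simp: paths_def)
qed

end
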